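(* Let $\mathcal{Q}$ be an $[\![n,k,d]\!]$ self-dual CSS code with $k \geq 1$. If $n$ is odd, then there exists a symplectic basis of $\mathcal{Q}$ which is compatible with multilevel transversal Clifford operations.
   Context: $[k]=\{1,\dots,k\}$. Self-dual CSS code: let $H\in\mathbb{Z}_2^{r\times n}$ be a full-row-rank parity check matrix, with rows $\mathbf{g}_1,\dots,\mathbf{g}_r$, of a binary linear code $\mathcal{D}$ with $\mathcal{D}^\perp\subseteq\mathcal{D}$ (dual with respect to the mod-2 dot product). $\mathcal{Q}$ is the stabilizer code whose stabilizer group $S$ is generated by, for each $i$, the $X$-type and the $Z$-type Pauli operators with support $\{q:(\mathbf{g}_i)_q=1\}$. It encodes $k=n-2r$ logical qubits; $d$ is its distance. Symplectic basis: let $C(S)$ be the group of all Pauli operators commuting with every element of $S$. A symplectic basis of $\mathcal{Q}$ is a set of $k$ pairs $\{(\bar X_j,\bar Z_j)\}_{j\in[k]}$ of Pauli operators in $C(S)$ which together with $S$ and $iI^{\otimes n}$ generate $C(S)$, such that $\bar X_j$ and $\bar Z_j$ anticommute for every $j$, while $\bar X_j,\bar Z_{j'}$ commute for $j\ne j'$, all $\bar X_j$'s commute with one another, and all $\bar Z_j$'s commute with one another. It defines the logical Pauli operators of the $k$ logical qubits and hence the logical gates. An equality between a logical gate and a physical gate means that the physical gate preserves $S$ under conjugation and implements that logical gate on the code space (up to global phase). $H_i$ and $S_i$ are the Hadamard gate and phase gate ($\mathrm{diag}(1,i)$) on physical qubit $i$; $\bar H_j,\bar S_j$ are the corresponding logical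 gates on logical qubit $j$ ($\bar H_j$ exchanges $\bar X_j$ and $\bar Z_j$; $\bar S_j$ maps $\bar X_j\mapsto i\bar X_j\bar Z_j$, $\bar Z_j\mapsto\bar Z_j$). A symplectic basis of $\mathcal{Q}$ is compatible with multilevel transversal Clifford operations if (i) $\bigotimes_{j=1}^k\bar H_j=\bigotimes_{i=1}^n H_i$; and (ii) for any $(a_1,\dots,a_k)\in\{-1,1\}^k$ there exists $(b_1,\dots,b_n)\in\{-1,1\}^n$ such that $\bigotimes_{j=1}^k\bar S_j^{a_j}=\bigotimes_{i=1}^nS_i^{b_i}$. *)

theory Defs
  imports "HOL-Analysis.Analysis" "HOL-Library.Z2" "HOL-Algebra.Generated_Groups"
begin

instance bit :: finite
proof
  have "(UNIV :: bit set) = {0, 1}"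
    using bit.exhaust by blast
  then show "finite (UNIV :: bit set)"
    by (metis finite.emptyI finite.insertI)
qed

section \<open>Operators on qubits\<close>

text \<open>
  The qubits are indexed by a finite type, so there are \<open>CARD('n)\<close> of them. The computational
  basis states are the bit vectors \<open>bit ^ 'n\<close>, and operators are matrices indexed by them.
\<close>

type_synonym gate1 = "complex ^ bit ^ bit"
type_synonym 'n operator = "complex ^ (bit ^ 'n) ^ (bit ^ 'n)"

definition dagger :: "complex ^ 'a ^ 'b \<Rightarrow> complex ^ 'b ^ 'a" where
  "dagger A = (\<chi> x y. cnj (A $ y $ x))"

definition tensor :: "('n::finite \<Rightarrow> gate1) \<Rightarrow> 'n operator" where
  "tensor G = (\<chi> x y. \<Prod>q\<in>UNIV. G q $ (x $ q) $ (y $ q))"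

definition on_qubit :: "'n::finite \<Rightarrow> gate1 \<Rightarrow> 'n operator" where
  "on_qubit j G = tensor (\<lambda>q. if q = j then G else mat 1)"

definition sigma_x :: gate1 where
  "sigma_x = (\<chi> a b. if a = b then 0 else 1)"

definition sigma_y :: gate1 where
  "sigma_y = (\<chi> a b. if a = b then 0 else if a = 0 then - \<i> else \<i>)"

definition sigma_z :: gate1 where
  "sigma_z = (\<chi> a b. if a \<noteq> b then 0 else if a = 0 then 1 else - 1)"

definition hadamard :: gate1 where
  "hadamard = (\<chi> a b. (if a = 1 \<and> b = 1 then - 1 else 1) / complex_of_real (sqrt 2))"

text \<open>The power \<open>S\<^sup>m\<close> of the phase gate \<open>S = diag(1, \<i>)\<close>, for an integer exponent.\<close>

definition phase_gate_pow :: "int \<Rightarrow> gate1" where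
  "phase_gate_pow m = (\<chi> a b. if a \<noteq> b then 0 else if a = 0 then 1 else \<i> powi m)"

section \<open>Pauli operators\<close>

definition pauli1 :: "gate1 set" where
  "pauli1 = {mat 1, sigma_x, sigma_y, sigma_z}"

definition pauli_ops :: "'n::finite operator set" where
  "pauli_ops = {mat (\<i> ^ m) ** tensor P | m P. \<forall>q. P q \<in> pauli1}"

definition pauli_group :: "'n::finite operator monoid" where
  "pauli_group = \<lparr>carrier = pauli_ops, mult = (**), one = mat 1\<rparr>"

definition x_type :: "bit ^ 'n \<Rightarrow> 'n::finite operator" where
  "x_type v = tensor (\<lambda>q. if v $ q = 1 then sigma_x else mat 1)"

definition z_type :: "bit ^ 'n \<Rightarrow> 'n::finite operator" where
  "z_type v = tensor (\<lambda>q. if v $ q = 1 then sigma_z else mat 1)"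

definition centralizer :: "'n::finite operator set \<Rightarrow> 'n operator set" where
  "centralizer S = {P \<in> pauli_ops. \<forall>s\<in>S. P ** s = s ** P}"

section \<open>Self-dual CSS codes\<close>

text \<open>
  A parity check matrix \<open>H\<close> with \<open>r\<close> rows is given by its rows \<open>H 1, \<dots>, H r\<close>; the number of rows
  is not encoded in a type because \<open>r = 0\<close> is allowed.
\<close>

definition bit_dot :: "bit ^ 'n \<Rightarrow> bit ^ 'n::finite \<Rightarrow> bit" where
  "bit_dot u v = (\<Sum>q\<in>UNIV. u $ q * v $ q)"

definition linear_code :: "nat \<Rightarrow> (nat \<Rightarrow> bit ^ 'n::finite) \<Rightarrow> (bit ^ 'n) set" where
  "linear_code r H = {v. \<forall>i\<in>{1..r}. bit_dot (H i) v = 0}"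

definition dual_code :: "(bit ^ 'n::finite) set \<Rightarrow> (bit ^ 'n) set" where
  "dual_code D = {u. \<forall>v\<in>D. bit_dot u v = 0}"

text \<open>Full row rank, and the code with parity check matrix \<open>H\<close> contains its dual.\<close>

definition self_dual_check_matrix :: "nat \<Rightarrow> (nat \<Rightarrow> bit ^ 'n::finite) \<Rightarrow> bool" where
  "self_dual_check_matrix r H \<longleftrightarrow>
     vec.dim (H ` {1..r}) = r \<and> dual_code (linear_code r H) \<subseteq> linear_code r H"

definition stabilizer :: "nat \<Rightarrow> (nat \<Rightarrow> bit ^ 'n::finite) \<Rightarrow> 'n operator set" where
  "stabilizer r H = generate pauli_group (x_type ` H ` {1..r} \<union> z_type ` H ` {1..r})"

definition code_space :: "'n::finite operator set \<Rightarrow> (complex ^ (bit ^ 'n)) set" where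
  "code_space S = {\<psi>. \<forall>s\<in>S. s *v \<psi> = \<psi>}"

text \<open>
  The least weight of a Pauli operator that commutes with \<open>S\<close> but is not, up to phase, in \<open>S\<close>.
\<close>

definition distance :: "'n::finite operator set \<Rightarrow> nat" where
  "distance S = (LEAST w. \<exists>P. (\<forall>q. P q \<in> pauli1) \<and> tensor P \<in> centralizer S \<and>
     (\<forall>m. mat (\<i> ^ m) ** tensor P \<notin> S) \<and> w = card {q. P q \<noteq> mat 1})"

section \<open>Symplectic bases and logical gates\<close>

text \<open>The logical qubits are indexed by a finite type as well.\<close>

definition symplectic_basis ::
    "'n::finite operator set \<Rightarrow> ('k::finite \<Rightarrow> 'n operator) \<Rightarrow> ('k \<Rightarrow> 'n operator) \<Rightarrow> bool" where
  "symplectic_basis S Xb Zb \<longleftrightarrow>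
     range Xb \<subseteq> centralizer S \<and> range Zb \<subseteq> centralizer S \<and>
     generate pauli_group (S \<union> {mat \<i>} \<union> range Xb \<union> range Zb) = centralizer S \<and>
     (\<forall>j. Xb j ** Zb j = - (Zb j ** Xb j)) \<and>
     (\<forall>j j'. j \<noteq> j' \<longrightarrow> Xb j ** Zb j' = Zb j' ** Xb j) \<and>
     (\<forall>j j'. Xb j ** Xb j' = Xb j' ** Xb j) \<and>
     (\<forall>j j'. Zb j ** Zb j' = Zb j' ** Zb j)"

text \<open>
  A symplectic basis defines the logical qubits through the unitary \<open>V\<close> from the state space of
  \<open>CARD('k)\<close> qubits onto the code space under which \<open>Xb j\<close> and \<open>Zb j\<close> become the Pauli operators
  \<open>X\<close> and \<open>Z\<close> of qubit \<open>j\<close>. Such a \<open>V\<close> is unique up to a global phase. It exists if and only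
  if all \<open>Xb j\<close> and \<open>Zb j\<close> square to the identity; a basis containing, say, \<open>\<i> X\<close> in place
  of \<open>X\<close> defines no logical qubits.
\<close>

definition encoder ::
    "'n::finite operator set \<Rightarrow> ('k::finite \<Rightarrow> 'n operator) \<Rightarrow> ('k \<Rightarrow> 'n operator) \<Rightarrow>
     complex ^ (bit ^ 'k) ^ (bit ^ 'n) \<Rightarrow> bool" where
  "encoder S Xb Zb V \<longleftrightarrow>
     dagger V ** V = mat 1 \<and> range ((*v) V) = code_space S \<and>
     (\<forall>j. Xb j ** V = V ** on_qubit j sigma_x) \<and>
     (\<forall>j. Zb j ** V = V ** on_qubit j sigma_z)"

text \<open>
  The logical version of a gate \<open>L\<close> on \<open>CARD('k)\<close> qubits is \<open>V L V\<^sup>\<dagger>\<close> on the code space. The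
  physical gate \<open>U\<close> equals it if \<open>U\<close> preserves \<open>S\<close> under conjugation and agrees with it on the
  code space, that is, on the range of \<open>V\<close>, up to a global phase. For \<open>L\<close> the Hadamard gate on qubit
  \<open>j\<close> this is the gate exchanging \<open>Xb j\<close> and \<open>Zb j\<close>; for the phase gate on qubit \<open>j\<close> it is the gate
  taking \<open>Xb j\<close> to \<open>\<i> Xb j Zb j\<close> and fixing \<open>Zb j\<close>.
\<close>

definition implements_logical ::
    "'n::finite operator set \<Rightarrow> ('k::finite \<Rightarrow> 'n operator) \<Rightarrow> ('k \<Rightarrow> 'n operator) \<Rightarrow>
     'n operator \<Rightarrow> 'k operator \<Rightarrow> bool" where
  "implements_logical S Xb Zb U L \<longleftrightarrow>
     (\<lambda>s. U ** s ** dagger U) ` S = S \<and>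
     (\<exists>V c. encoder S Xb Zb V \<and> cmod c = 1 \<and> U ** V = mat c ** (V ** L))"

definition multilevel_transversal_compatible ::
    "'n::finite operator set \<Rightarrow> ('k::finite \<Rightarrow> 'n operator) \<Rightarrow> ('k \<Rightarrow> 'n operator) \<Rightarrow> bool" where
  "multilevel_transversal_compatible S Xb Zb \<longleftrightarrow>
     implements_logical S Xb Zb (tensor (\<lambda>_. hadamard)) (tensor (\<lambda>_. hadamard)) \<and>
     (\<forall>a :: 'k \<Rightarrow> int. range a \<subseteq> {-1, 1} \<longrightarrow>
        (\<exists>b :: 'n \<Rightarrow> int. range b \<subseteq> {-1, 1} \<and>
           implements_logical S Xb Zb
             (tensor (\<lambda>i. phase_gate_pow (b i))) (tensor (\<lambda>j. phase_gate_pow (a j)))))"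

end

theory Submission
  imports Defs
begin

text \<open>
  Let \<open>C\<close> be the row space of the check matrix, so \<open>C \<subseteq> C\<^sup>\<bottom>\<close>. As \<open>n\<close> is odd, the all-ones
  vector lies in \<open>C\<^sup>\<bottom>\<close> and has square 1, so the form on \<open>C\<^sup>\<bottom> / C\<close> is not alternating and
  has an orthonormal basis \<open>u\<^sub>1, \<dots>, u\<^sub>k\<close>. Take \<open>X(u\<^sub>j)\<close> and \<open>Z(u\<^sub>j)\<close> as logical operators;
  the transversal Hadamard gate exchanges them.

  For signs \<open>b\<^sub>i = \<plusminus>1\<close>, the diagonal gate with factors \<open>S\<^sub>i\<close> to the power \<open>b\<^sub>i\<close> multiplies the
  basis state \<open>x\<close> by a phase \<open>p(x)\<close> with \<open>p(x + y) = (-1)\<^bsup>x \<cdot> y\<^esup> p(x) p(y)\<close>. Hence \<open>p\<close> is a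
  character with values \<open>\<plusminus>1\<close> on \<open>C\<close>, and \<open>p(u\<^sub>j) = \<plusminus>\<i>\<close>. Changing \<open>b\<close> on the support of \<open>c\<close>
  multiplies \<open>p(x)\<close> by \<open>(-1)\<^bsup>c \<cdot> x\<^esup>\<close>, so \<open>c\<close> can be chosen to make \<open>p\<close> trivial on \<open>C\<close> and
  to give the \<open>p(u\<^sub>j)\<close> any prescribed signs.
\<close>

text \<open>Sums and products of bits stay in ring form, where distributivity and the laws for
  finite sums apply, rather than turning into Boolean operations.\<close>

declare add_bit_eq_xor [simp del] mult_bit_eq_and [simp del]

section \<open>Orthogonality over the two-element field\<close>

lemma bit_add_self [simp]: "(a::bit) + a = 0"
  by (cases a) auto

lemma bit_mult_self [simp]: "(a::bit) * a = a"
  by (cases a) auto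

lemma bit_vec_add_self [simp]: "(x::bit ^ 'n) + x = 0"
  by (simp add: vec_eq_iff)

lemma bit_vec_add_left_cancel [simp]: "(x::bit ^ 'n) + (x + y) = y"
  by (simp flip: add.assoc)

lemma bit_vec_minus [simp]: "(x::bit ^ 'n) - y = x + y"
  by (simp add: vec_eq_iff)

lemma bit_vec_add_eq_0_iff: "(x::bit ^ 'n) + y = 0 \<longleftrightarrow> x = y"
  by (metis bit_vec_add_left_cancel add_0_right)

lemma bit_add_eq_0_iff: "(a::bit) + b = 0 \<longleftrightarrow> a = b"
  by (cases a; cases b) auto

lemma of_nat_bit: "(of_nat m :: bit) = (if even m then 0 else 1)"
  by (induction m) auto

lemma bit_subspaceI:
  fixes A :: "(bit ^ 'n::finite) set"
  assumes "0 \<in> A" "\<And>x y. x \<in> A \<Longrightarrow> y \<in> A \<Longrightarrow> x + y \<in> A"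
  shows "vec.subspace A"
proof (rule vec.subspaceI)
  fix c :: bit and x assume "x \<in> A"
  then show "c *s x \<in> A" using assms(1) by (cases c) auto
qed (use assms in auto)

section \<open>Dot products and dual codes\<close>

lemma bit_dot_commute: "bit_dot x y = bit_dot y x"
  by (simp add: bit_dot_def mult.commute)

lemma bit_dot_add_left: "bit_dot (x + y) z = bit_dot x z + bit_dot y z"
  by (simp add: bit_dot_def sum.distrib distrib_right)

lemma bit_dot_add_right: "bit_dot z (x + y) = bit_dot z x + bit_dot z y"
  by (simp add: bit_dot_def sum.distrib distrib_left)

lemma bit_dot_zero_left [simp]: "bit_dot 0 x = 0"
  by (simp add: bit_dot_def)

lemma bit_dot_zero_right [simp]: "bit_dot x 0 = 0"
  by (simp add: bit_dot_def)

lemma bit_dot_scale_right: "bit_dot x (c *s y) = c * bit_dot x y"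
  by (simp add: bit_dot_def sum_distrib_left mult.left_commute)

lemma bit_dot_sum_right: "bit_dot x (\<Sum>i\<in>I. f i) = (\<Sum>i\<in>I. bit_dot x (f i))"
  by (induction I rule: infinite_finite_induct) (simp_all add: bit_dot_add_right)

lemma bit_dot_axis_left: "bit_dot (axis j 1) x = x $ j"
proof -
  have "bit_dot (axis j 1) x = (\<Sum>q\<in>UNIV. if q = j then x $ q else 0)"
    unfolding bit_dot_def axis_def by (rule sum.cong) auto
  then show ?thesis by simp
qed

lemma bit_eq_0_if_dot_eq_0: "(\<And>x. bit_dot x y = 0) \<Longrightarrow> y = 0"
  by (metis bit_dot_axis_left vec_eq_iff zero_index)

lemma dual_code_antimono: "A \<subseteq> B \<Longrightarrow> dual_code B \<subseteq> dual_code A"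
  by (auto simp: dual_code_def)

lemma subset_dual_code_commute: "A \<subseteq> dual_code B \<longleftrightarrow> B \<subseteq> dual_code A"
  unfolding dual_code_def subset_iff Ball_def mem_Collect_eq by (metis bit_dot_commute)

lemma subspace_dual_code: "vec.subspace (dual_code A)"
  by (rule bit_subspaceI) (auto simp: dual_code_def bit_dot_add_left)

lemma dual_code_span: "dual_code (vec.span B) = dual_code B"
proof
  show "dual_code (vec.span B) \<subseteq> dual_code B"
    by (auto simp: dual_code_def intro: vec.span_base)
  have "vec.span B \<subseteq> {v. bit_dot u v = 0}" if "u \<in> dual_code B" for u
    by (rule vec.span_minimal) (use that in \<open>auto simp: dual_code_def bit_dot_add_right intro!: bit_subspaceI\<close>)
  then show "dual_code B \<subseteq> dual_code (vec.span B)"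
    by (force simp: dual_code_def)
qed

section \<open>Characters and double duality\<close>

definition bit_sign :: "bit \<Rightarrow> complex" where
  "bit_sign b = (if b = 0 then 1 else - 1)"

lemma bit_sign_0 [simp]: "bit_sign 0 = 1" and bit_sign_1 [simp]: "bit_sign 1 = - 1"
  by (simp_all add: bit_sign_def)

lemma bit_sign_add: "bit_sign (a + b) = bit_sign a * bit_sign b"
  by (cases a; cases b) auto

lemma bit_sign_sum: "bit_sign (\<Sum>i\<in>I. f i) = (\<Prod>i\<in>I. bit_sign (f i))"
  by (induction I rule: infinite_finite_induct) (simp_all add: bit_sign_add)

lemma bit_sign_self [simp]: "bit_sign a * bit_sign a = 1"
  by (cases a) auto

lemma cnj_bit_sign [simp]: "cnj (bit_sign a) = bit_sign a"
  by (cases a) auto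

lemma bit_sign_nonzero [simp]: "bit_sign a \<noteq> 0"
  by (cases a) auto

lemma bit_sign_eq_iff: "bit_sign a = bit_sign b \<longleftrightarrow> a = b"
  by (cases a; cases b) auto

lemma sum_subspace_translate:
  fixes A :: "(bit ^ 'n::finite) set"
  assumes "vec.subspace A" "h \<in> A"
  shows "(\<Sum>g\<in>A. f (g + h)) = (\<Sum>g\<in>A. f g)"
  by (rule sum.reindex_bij_witness[of _ "\<lambda>g. g + h" "\<lambda>g. g + h"])
    (use assms in \<open>auto simp: add.assoc vec.subspace_add\<close>)

text \<open>Orthogonality of characters: if some \<open>h\<close> in \<open>A\<close> has product 1
  with \<open>x\<close>, translating the sum by \<open>h\<close> negates it, so it vanishes.\<close>

lemma character_sum:
  fixes A :: "(bit ^ 'n::finite) set"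
  assumes "vec.subspace A"
  shows "(\<Sum>g\<in>A. bit_sign (bit_dot x g)) = (if x \<in> dual_code A then of_nat (card A) else 0)"
proof (cases "x \<in> dual_code A")
  case True
  then show ?thesis by (simp add: dual_code_def)
next
  case False
  then obtain h where h: "h \<in> A" "bit_dot x h = 1"
    by (auto simp: dual_code_def)
  have "(\<Sum>g\<in>A. bit_sign (bit_dot x g)) = (\<Sum>g\<in>A. bit_sign (bit_dot x (g + h)))"
    by (rule sum_subspace_translate[OF assms h(1), symmetric])
  also have "\<dots> = - (\<Sum>g\<in>A. bit_sign (bit_dot x g))"
    by (simp only: bit_dot_add_right bit_sign_add h(2) bit_sign_1 mult_minus1_right sum_negf)
  finally show ?thesis using False by simp
qed

lemma card_bit [simp]: "CARD(bit) = 2"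
proof -
  have "(UNIV :: bit set) = {0, 1}"
    using bit.exhaust by blast
  then show ?thesis by (metis card_2_iff zero_neq_one)
qed

lemma dual_code_UNIV: "dual_code UNIV = {0}"
  by (auto simp: dual_code_def) (metis bit_dot_commute bit_eq_0_if_dot_eq_0)

text \<open>Double counting of the signs over all \<open>x\<close> and all \<open>g\<close> in
  \<open>A\<close>: summing over \<open>g\<close> first leaves the \<open>x\<close> in the dual,
  summing over \<open>x\<close> first leaves only \<open>g = 0\<close>.\<close>

lemma card_mult_card_dual_code:
  fixes A :: "(bit ^ 'n::finite) set"
  assumes "vec.subspace A"
  shows "card A * card (dual_code A) = 2 ^ CARD('n)"
proof -
  have "(\<Sum>x\<in>UNIV. \<Sum>g\<in>A. bit_sign (bit_dot x g))
      = (\<Sum>x\<in>UNIV. if x \<in> dual_code A then of_nat (card A) else 0)"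
    by (simp add: character_sum[OF assms])
  also have "\<dots> = of_nat (card A * card (dual_code A))"
    by (simp flip: sum.inter_filter)
  also have "(\<Sum>x\<in>UNIV. \<Sum>g\<in>A. bit_sign (bit_dot x g))
      = (\<Sum>g\<in>A. \<Sum>x\<in>UNIV. bit_sign (bit_dot g x))"
    by (subst sum.swap) (simp add: bit_dot_commute)
  also have "\<dots> = (\<Sum>g\<in>A. if g = 0 then 2 ^ CARD('n) else 0)"
    by (simp add: character_sum[OF vec.subspace_UNIV] dual_code_UNIV cong: if_cong)
  also have "\<dots> = 2 ^ CARD('n)"
    using vec.subspace_0[OF assms] by simp
  finally have "of_nat (card A * card (dual_code A)) = (of_nat (2 ^ CARD('n)) :: complex)"
    by simp
  then show ?thesis by (simp only: of_nat_eq_iff)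
qed

text \<open>One inclusion is immediate; the cardinality formula for \<open>A\<close> and for its
  dual forces equality.\<close>

lemma dual_dual_code:
  fixes A :: "(bit ^ 'n::finite) set"
  assumes "vec.subspace A"
  shows "dual_code (dual_code A) = A"
proof (rule sym, rule card_subset_eq)
  show "A \<subseteq> dual_code (dual_code A)"
    by (auto simp: dual_code_def bit_dot_commute)
  have "card (dual_code A) > 0"
    using vec.subspace_0[OF subspace_dual_code] by (auto simp: card_gt_0_iff)
  moreover have "card (dual_code A) * card (dual_code (dual_code A)) = card (dual_code A) * card A"
    using card_mult_card_dual_code[OF assms] card_mult_card_dual_code[OF subspace_dual_code]
    by (metis mult.commute)
  ultimately show "card A = card (dual_code (dual_code A))" by (metis mult_cancel1 less_irrefl)
qed simp

text \<open>The kernel \<open>K\<close> of a nonzero \<open>f\<close> is proper, so by double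
  duality some \<open>c\<close> is orthogonal to \<open>K\<close> but not to \<open>W\<close>. As
  \<open>K\<close> has index 2 in \<open>W\<close>, this \<open>c\<close> represents
  \<open>f\<close>.\<close>

lemma additive_functional_is_dot:
  fixes W :: "(bit ^ 'n::finite) set"
  assumes W: "vec.subspace W" and f: "\<And>x y. x \<in> W \<Longrightarrow> y \<in> W \<Longrightarrow> f (x + y) = f x + f y"
  obtains c where "\<And>x. x \<in> W \<Longrightarrow> f x = bit_dot c x"
proof -
  define K where "K = {x \<in> W. f x = 0}"
  have "f 0 = 0" using f[of 0 0] vec.subspace_0[OF W] by simp
  then have K: "vec.subspace K"
    by (intro bit_subspaceI) (auto simp: K_def f vec.subspace_add[OF W] vec.subspace_0[OF W])
  show ?thesis
  proof (cases "K = W")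
    case True
    then show ?thesis by (intro that[of 0]) (auto simp: K_def)
  next
    case False
    then have "\<not> dual_code K \<subseteq> dual_code W"
      using dual_code_antimono[of "dual_code K" "dual_code W"]
      unfolding dual_dual_code[OF K] dual_dual_code[OF W] by (auto simp: K_def)
    then obtain c where c: "c \<in> dual_code K" "c \<notin> dual_code W" by blast
    then obtain w where w: "w \<in> W" "bit_dot c w = 1"
      by (auto simp: dual_code_def)
    with c have "f w = 1" by (auto simp: dual_code_def K_def)
    have "f x = bit_dot c x" if x: "x \<in> W" for x
    proof (cases "f x = 0")
      case True
      then show ?thesis using c x by (auto simp: dual_code_def K_def)
    next
      case False
      then have "x + w \<in> K" using x w \<open>f w = 1\<close> by (simp add: K_def f vec.subspace_add[OF W])
      then have "bit_dot c (x + w) = 0" using c by (auto simp: dual_code_def)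
      then show ?thesis using False w by (simp add: bit_dot_add_right bit_add_eq_0_iff)
    qed
    then show ?thesis by (rule that)
  qed
qed

section \<open>Cardinality in place of dimension\<close>

lemma card_span_insert:
  fixes B :: "(bit ^ 'n::finite) set"
  assumes "b \<notin> vec.span B"
  shows "card (vec.span (insert b B)) = 2 * card (vec.span B)"
proof -
  \<comment> \<open>The only scalars are 0 and 1, so the new span consists of the old one and its
    translate by \<open>b\<close>; these are disjoint because \<open>b\<close> is not in the old
    span.\<close>
  have "vec.span (insert b B) = vec.span B \<union> (\<lambda>x. x + b) ` vec.span B" (is "?L = ?R")
  proof
    show "?L \<subseteq> ?R"
    proof
      fix x assume "x \<in> ?L"
      then obtain k where k: "x - k *s b \<in> vec.span B" by (auto simp: vec.span_insert)
      show "x \<in> ?R"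
      proof (cases "k = 0")
        case True
        then show ?thesis using k by simp
      next
        case False
        then show ?thesis using k by (auto intro!: image_eqI[of _ _ "x + b"] simp: add.assoc)
      qed
    qed
    show "?R \<subseteq> ?L"
      by (auto intro: vec.span_add vec.span_base vec.span_mono[THEN subsetD])
  qed
  moreover have "vec.span B \<inter> (\<lambda>x. x + b) ` vec.span B = {}"
    using assms vec.span_add_eq by (auto simp: vec.span_add_eq)
  moreover have "card ((\<lambda>x. x + b) ` vec.span B) = card (vec.span B)"
    by (rule card_image) (auto intro: inj_onI)
  ultimately show ?thesis by (simp add: card_Un_disjoint)
qed

lemma card_span_independent:
  fixes B :: "(bit ^ 'n::finite) set"
  assumes "vec.independent B"
  shows "card (vec.span B) = 2 ^ card B"
proof -
  have "finite B" by simp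
  then show ?thesis using assms
    by induction (auto simp: vec.independent_insert card_span_insert)
qed

lemma card_span:
  fixes A :: "(bit ^ 'n::finite) set"
  shows "card (vec.span A) = 2 ^ vec.dim A"
proof -
  obtain B where B: "B \<subseteq> A" "vec.independent B" "A \<subseteq> vec.span B" "card B = vec.dim A"
    by (rule vec.basis_exists)
  then have "vec.span A = vec.span B"
    by (metis vec.span_mono vec.span_span subset_antisym)
  then show ?thesis using card_span_independent B by metis
qed

section \<open>Orthonormal systems in the dual code\<close>

definition orthonormal :: "(bit ^ 'n::finite) set \<Rightarrow> bool" where
  "orthonormal B \<longleftrightarrow> (\<forall>x\<in>B. \<forall>y\<in>B. bit_dot x y = (if x = y then 1 else 0))"

text \<open>
  Splitting off a vector \<open>w\<close> with \<open>w \<cdot> w = 1\<close> may leave an alternating complement, in which no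
  further vector can be split off. If this complement contains \<open>a, b\<close> with \<open>a \<cdot> b = 1\<close>, then
  splitting off \<open>w + a\<close> instead leaves \<open>w + b\<close>, whose square is 1.
\<close>

lemma maximal_orthonormal_exists:
  fixes W :: "(bit ^ 'n::finite) set"
  assumes "vec.subspace W" "w \<in> W" "bit_dot w w = 1"
  shows "\<exists>B\<subseteq>W. orthonormal B \<and>
    (\<forall>x\<in>W \<inter> dual_code B. \<forall>y\<in>W \<inter> dual_code B. bit_dot x y = 0)"
  using assms
proof (induction "card W" arbitrary: W w rule: less_induct)
  case less
  note W = less.prems(1)
  \<comment> \<open>The induction hypothesis for the complement of \<open>w'\<close> needs a vector
    of square 1 inside it; \<open>v\<close> is that vector.\<close>
  have split: ?case if w': "w' \<in> W" "bit_dot w' w' = 1"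
    and v: "v \<in> W" "bit_dot v w' = 0" "bit_dot v v = 1" for w' v
  proof -
    define W' where "W' = W \<inter> dual_code {w'}"
    have W': "vec.subspace W'"
      unfolding W'_def by (intro vec.subspace_inter W subspace_dual_code)
    have "W' \<subseteq> W" "w' \<notin> W'"
      using w' by (auto simp: W'_def dual_code_def)
    then have "card W' < card W"
      using w'(1) by (intro psubset_card_mono) auto
    then have "\<exists>B\<subseteq>W'. orthonormal B \<and>
        (\<forall>x\<in>W' \<inter> dual_code B. \<forall>y\<in>W' \<inter> dual_code B. bit_dot x y = 0)"
      by (rule less.hyps[OF _ W', of v]) (use v in \<open>auto simp: W'_def dual_code_def\<close>)
    then obtain B where B: "B \<subseteq> W'" "orthonormal B"
      "\<forall>x\<in>W' \<inter> dual_code B. \<forall>y\<in>W' \<inter> dual_code B. bit_dot x y = 0"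
      by blast
    have "orthonormal (insert w' B)"
      using B(1,2) w' by (auto simp: orthonormal_def W'_def dual_code_def bit_dot_commute)
    moreover have "W \<inter> dual_code (insert w' B) = W' \<inter> dual_code B"
      by (auto simp: W'_def dual_code_def)
  ultimately show ?thesis
      using B(1,3) w'(1) \<open>W' \<subseteq> W\<close> by (intro exI[of _ "insert w' B"]) simp
  qed
  show ?case
  proof (cases "\<forall>x\<in>W \<inter> dual_code {w}. \<forall>y\<in>W \<inter> dual_code {w}. bit_dot x y = 0")
    case True
    then show ?thesis using less.prems by (intro exI[of _ "{w}"]) (auto simp: orthonormal_def)
  next
    case False
    then obtain a b where "a \<in> W \<inter> dual_code {w}" "b \<in> W \<inter> dual_code {w}" "bit_dot a b \<noteq> 0"
      by blast
    then have ab: "a \<in> W" "b \<in> W" "bit_dot a w = 0" "bit_dot b w = 0" "bit_dot a b = 1"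
      by (auto simp: dual_code_def)
    have comm: "bit_dot w a = 0" "bit_dot w b = 0" "bit_dot b a = 1"
      using ab by (simp_all add: bit_dot_commute)
    show ?thesis
    proof (cases "bit_dot a a = 1 \<or> bit_dot b b = 1")
      case True
      then show ?thesis using split less.prems ab by blast
    next
      case False
      then show ?thesis
        using split[of "w + a" "w + b"] less.prems ab comm W
        by (simp add: vec.subspace_add bit_dot_add_left bit_dot_add_right)
    qed
  qed
qed

text \<open>Each vector of \<open>B\<close> is orthogonal to \<open>A\<close> and to the rest of
  \<open>B\<close> but not to itself. Hence it is outside their span, and inserting it doubles the
  span.\<close>

lemma card_span_Un_orthonormal:
  fixes A B :: "(bit ^ 'n::finite) set"
  assumes "orthonormal B" "B \<subseteq> dual_code A"
  shows "card (vec.span (A \<union> B)) = 2 ^ card B * card (vec.span A)"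
proof -
  have "finite B" by simp
  then show ?thesis using assms
  proof induction
    case (insert b B)
    have "b \<in> dual_code (vec.span (A \<union> B))"
      unfolding dual_code_span
      using insert.prems insert.hyps by (auto simp: dual_code_def orthonormal_def)
    moreover have "bit_dot b b = 1" using insert.prems by (auto simp: orthonormal_def)
    ultimately have "b \<notin> vec.span (A \<union> B)" by (auto simp: dual_code_def)
    then show ?case
      using insert by (simp add: card_span_insert orthonormal_def)
  qed simp
qed

text \<open>The \<open>u j\<close> enumerate a maximal orthonormal set \<open>B\<close> in
  \<open>dual_code C\<close>. What is orthogonal to \<open>B\<close> in there is isotropic, which
  forces it to be \<open>C\<close>; counting then shows that \<open>B\<close> has as many elements
  as there are logical qubits.\<close>

lemma logical_vectors_exist:
  fixes C :: "(bit ^ 'n::finite) set"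
  assumes C: "vec.subspace C" "C \<subseteq> dual_code C" "card C = 2 ^ r"
    and k: "CARD('k::finite) + 2 * r = CARD('n)" and "odd CARD('n)"
  obtains u :: "'k::finite \<Rightarrow> bit ^ 'n" where "\<And>j. u j \<in> dual_code C"
    and "\<And>i j. bit_dot (u i) (u j) = (if i = j then 1 else 0)"
    and "\<And>x. x \<in> dual_code C \<Longrightarrow> (\<And>j. bit_dot (u j) x = 0) \<Longrightarrow> x \<in> C"
proof -
  define e :: "bit ^ 'n" where "e = (\<chi> i. 1)"
  have ee: "bit_dot e e = 1"
    using \<open>odd CARD('n)\<close> by (simp add: e_def bit_dot_def of_nat_bit)
  \<comment> \<open>Squaring is the identity on bits, so the product with \<open>e\<close> is the
    self-product, which vanishes on the self-orthogonal \<open>C\<close>.\<close>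
  have "bit_dot e g = bit_dot g g" for g
    by (simp add: bit_dot_def e_def)
  then have "e \<in> dual_code C" using C(2) by (auto simp: dual_code_def)
  then obtain B where B: "B \<subseteq> dual_code C" "orthonormal B"
    and iso: "\<And>x y. x \<in> dual_code C \<inter> dual_code B \<Longrightarrow> y \<in> dual_code C \<inter> dual_code B \<Longrightarrow> bit_dot x y = 0"
    using maximal_orthonormal_exists[OF subspace_dual_code _ ee] by metis
  \<comment> \<open>Orthogonal projection: the coefficient of \<open>b\<close> is its product with
    \<open>x\<close>, and in characteristic 2 adding the projection removes it.\<close>
  have dec: "\<exists>b\<in>vec.span B. x + b \<in> dual_code B" for x
  proof (intro bexI[of _ "\<Sum>b\<in>B. bit_dot b x *s b"])
    have "bit_dot y (\<Sum>b\<in>B. bit_dot b x *s b) = bit_dot y x" if "y \<in> B" for y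
    proof -
      have "bit_dot y (\<Sum>b\<in>B. bit_dot b x *s b) = (\<Sum>b\<in>B. if b = y then bit_dot b x else 0)"
        unfolding bit_dot_sum_right bit_dot_scale_right
        using B(2) that by (intro sum.cong) (auto simp: orthonormal_def)
      then show ?thesis using that by simp
    qed
    then show "x + (\<Sum>b\<in>B. bit_dot b x *s b) \<in> dual_code B"
      by (auto simp: dual_code_def bit_dot_add_right bit_dot_commute bit_dot_add_left)
  qed (intro vec.span_sum vec.span_scale vec.span_base)
  have rad: "dual_code C \<inter> dual_code B = C"
  proof
    show "C \<subseteq> dual_code C \<inter> dual_code B"
      using B(1) C(2) by (simp add: subset_dual_code_commute)
    \<comment> \<open>By double duality it suffices that \<open>x\<close> is orthogonal to every
      \<open>y\<close> in \<open>dual_code C\<close>. It is orthogonal to the part of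
      \<open>y\<close> in the span of \<open>B\<close> by choice, and to the remainder by
      \<open>iso\<close>.\<close>
    have "x \<in> dual_code (dual_code C)" if x: "x \<in> dual_code C \<inter> dual_code B" for x
      unfolding dual_code_def[of "dual_code C"]
    proof safe
      fix y assume y: "y \<in> dual_code C"
      obtain b where b: "b \<in> vec.span B" "y + b \<in> dual_code B" using dec by blast
      have "b \<in> dual_code C"
        using b(1) B(1) vec.span_minimal[OF _ subspace_dual_code] by blast
      then have "bit_dot x (y + b) = 0"
        using iso x b y vec.subspace_add[OF subspace_dual_code] by blast
      moreover have "bit_dot x b = 0"
        using x b(1) dual_code_span[of B] by (auto simp: dual_code_def)
    ultimately show "bit_dot x y = 0" by (simp add: bit_dot_add_right)
    qed
    then show "dual_code C \<inter> dual_code B \<subseteq> C" using dual_dual_code[OF C(1)] by blast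
  qed
  have "dual_code (vec.span (C \<union> B)) = C"
    using rad unfolding dual_code_span by (auto simp: dual_code_def)
  \<comment> \<open>The span of \<open>C\<close> and \<open>B\<close> has 2^(card B + r) elements
    and its dual \<open>C\<close> has 2^r.\<close>
  then have "2 ^ card B * 2 ^ r * 2 ^ r = (2 ^ CARD('n) :: nat)"
    using card_mult_card_dual_code[OF vec.subspace_span, of "C \<union> B"]
      card_span_Un_orthonormal[OF B(2,1)] C by (simp add: vec.span_eq_iff[THEN iffD2])
  then have "2 ^ (card B + r + r) = (2 ^ CARD('n) :: nat)" by (simp add: power_add)
  then have "card B = CARD('k)" using k by (subst (asm) power_inject_exp) auto
  then obtain u :: "'k \<Rightarrow> bit ^ 'n" where u: "bij_betw u UNIV B"
    using finite_same_card_bij[of "UNIV :: 'k set" B] by auto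
  show ?thesis
  proof
    show "u j \<in> dual_code C" for j using u B(1) by (auto dest: bij_betwE)
    show "bit_dot (u i) (u j) = (if i = j then 1 else 0)" for i j
      using u B(2) by (auto simp: orthonormal_def bij_betw_def inj_eq)
    show "x \<in> C" if "x \<in> dual_code C" "\<And>j. bit_dot (u j) x = 0" for x
    proof -
      have "x \<in> dual_code B"
        using u that(2) by (auto simp: dual_code_def bij_betw_def bit_dot_commute)
      then show ?thesis using rad that(1) by blast
    qed
  qed
qed

section \<open>Pauli operators\<close>

text \<open>The one-qubit operator \<open>c X^a Z^b\<close>; the scalar is there for
  \<open>sigma_y\<close>, which is \<open>\<i> X Z\<close>.\<close>

definition weyl1 :: "complex \<Rightarrow> bit \<Rightarrow> bit \<Rightarrow> gate1" where
  "weyl1 c a b = (\<chi> x y. if x = y + a then c * bit_sign (b * y) else 0)"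

text \<open>The operator \<open>c X\<^sup>u Z\<^sup>v\<close>.\<close>

definition weyl :: "complex \<Rightarrow> bit ^ 'n \<Rightarrow> bit ^ 'n \<Rightarrow> 'n::finite operator" where
  "weyl c u v = (\<chi> x y. if x = y + u then c * bit_sign (bit_dot v y) else 0)"

lemma tensor_weyl1:
  "tensor (\<lambda>q. weyl1 (c q) (u $ q) (v $ q)) = weyl (\<Prod>q\<in>UNIV. c q) u v"
proof -
  have "(\<Prod>q\<in>UNIV. weyl1 (c q) (u $ q) (v $ q) $ (x $ q) $ (y $ q))
      = (if x = y + u then (\<Prod>q\<in>UNIV. c q) * bit_sign (bit_dot v y) else 0)" for x y
  proof (cases "x = y + u")
    case True
    then show ?thesis by (simp add: weyl1_def bit_dot_def bit_sign_sum prod.distrib)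
  next
    case False
    then obtain q where "x $ q \<noteq> y $ q + u $ q" by (auto simp: vec_eq_iff)
    then show ?thesis using False by (auto simp: weyl1_def intro!: prod_zero)
  qed
  then show ?thesis by (simp add: tensor_def weyl_def)
qed

lemma mat_1_eq_weyl1: "mat 1 = weyl1 1 0 0"
  by (simp add: weyl1_def mat_def vec_eq_iff)

lemma sigma_x_eq_weyl1: "sigma_x = weyl1 1 1 0"
proof -
  have "sigma_x $ a $ b = weyl1 1 1 0 $ a $ b" for a b
    by (cases a; cases b) (simp_all add: weyl1_def sigma_x_def)
  then show ?thesis by (simp add: vec_eq_iff)
qed

lemma sigma_z_eq_weyl1: "sigma_z = weyl1 1 0 1"
proof -
  have "sigma_z $ a $ b = weyl1 1 0 1 $ a $ b" for a b
    by (cases a; cases b) (simp_all add: weyl1_def sigma_z_def)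
  then show ?thesis by (simp add: vec_eq_iff)
qed

lemma sigma_y_eq_weyl1: "sigma_y = weyl1 \<i> 1 1"
proof -
  have "sigma_y $ a $ b = weyl1 \<i> 1 1 $ a $ b" for a b
    by (cases a; cases b) (simp_all add: weyl1_def sigma_y_def)
  then show ?thesis by (simp add: vec_eq_iff)
qed

lemma x_type_eq_weyl: "x_type u = weyl 1 u 0"
proof -
  have "(if b = 1 then sigma_x else mat 1) = weyl1 1 b 0" for b
    by (cases b) (auto simp: sigma_x_eq_weyl1 mat_1_eq_weyl1)
  then show ?thesis using tensor_weyl1[of "\<lambda>_. 1" u 0] by (simp add: x_type_def)
qed

lemma z_type_eq_weyl: "z_type v = weyl 1 0 v"
proof -
  have "(if b = 1 then sigma_z else mat 1) = weyl1 1 0 b" for b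
    by (cases b) (auto simp: sigma_z_eq_weyl1 mat_1_eq_weyl1)
  then show ?thesis using tensor_weyl1[of "\<lambda>_. 1" 0 v] by (simp add: z_type_def)
qed

lemma on_qubit_sigma_x: "on_qubit j sigma_x = weyl 1 (axis j 1) 0"
proof -
  have "on_qubit j sigma_x = x_type (axis j 1)"
    unfolding on_qubit_def x_type_def axis_def by (rule arg_cong[of _ _ tensor]) auto
  then show ?thesis by (simp add: x_type_eq_weyl)
qed

lemma on_qubit_sigma_z: "on_qubit j sigma_z = weyl 1 0 (axis j 1)"
proof -
  have "on_qubit j sigma_z = z_type (axis j 1)"
    unfolding on_qubit_def z_type_def axis_def by (rule arg_cong[of _ _ tensor]) auto
  then show ?thesis by (simp add: z_type_eq_weyl)
qed

lemma mat_eq_weyl: "(mat c :: 'n::finite operator) = weyl c 0 0"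
  by (simp add: mat_def weyl_def vec_eq_iff)

lemma bit_vec_eq_add_iff: "(x::bit ^ 'n) = y + u \<longleftrightarrow> y = x + u"
  by (metis add.commute bit_vec_add_left_cancel)

lemma weyl_mult_left: "(weyl c u v ** A) $ x $ y = c * bit_sign (bit_dot v (x + u)) * A $ (x + u) $ y"
proof -
  have "(weyl c u v ** A) $ x $ y
      = (\<Sum>k\<in>UNIV. if k = x + u then c * bit_sign (bit_dot v k) * A $ k $ y else 0)"
    unfolding matrix_matrix_mult_def weyl_def by (simp add: bit_vec_eq_add_iff if_distrib[of "\<lambda>a. a * _"] cong: if_cong)
  then show ?thesis by simp
qed

lemma weyl_mult_right: "(A ** weyl c u v) $ x $ y = A $ x $ (y + u) * (c * bit_sign (bit_dot v y))"
proof -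
  have "(A ** weyl c u v) $ x $ y
      = (\<Sum>k\<in>UNIV. if k = y + u then A $ x $ k * (c * bit_sign (bit_dot v y)) else 0)"
    unfolding matrix_matrix_mult_def weyl_def by (simp add: if_distrib[of "\<lambda>a. _ * a"] cong: if_cong)
  then show ?thesis by simp
qed

lemma weyl_vector: "(weyl c u v *v \<psi>) $ x = c * bit_sign (bit_dot v (x + u)) * \<psi> $ (x + u)"
proof -
  have "(weyl c u v *v \<psi>) $ x
      = (\<Sum>k\<in>UNIV. if k = x + u then c * bit_sign (bit_dot v k) * \<psi> $ k else 0)"
    unfolding matrix_vector_mult_def weyl_def by (simp add: bit_vec_eq_add_iff if_distrib[of "\<lambda>a. a * _"] cong: if_cong)
  then show ?thesis by simp
qed

text \<open>Moving \<open>Z^v\<close> past \<open>X^u'\<close> costs the sign of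
  \<open>bit_dot v u'\<close>; all commutation relations below come from this.\<close>

lemma weyl_mult_weyl:
  "weyl c u v ** weyl c' u' v' = weyl (c * c' * bit_sign (bit_dot v u')) (u + u') (v + v')"
  by (simp add: vec_eq_iff weyl_mult_right)
    (auto simp: weyl_def bit_dot_add_right bit_dot_add_left bit_sign_add algebra_simps)

lemma weyl_eq_iff: "weyl c u v = weyl c' u v \<longleftrightarrow> c = c'"
proof
  assume "weyl c u v = weyl c' u v"
  \<comment> \<open>The sign is trivial in column 0, so the entry in row \<open>u\<close> is the
    scalar itself.\<close>
  then have "weyl c u v $ u $ 0 = weyl c' u v $ u $ 0" by simp
  then show "c = c'" by (simp add: weyl_def)
qed simp

lemma minus_weyl: "- weyl c u v = weyl (- c) u v"
  by (simp add: vec_eq_iff weyl_def)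

lemma weyl_commute_iff:
  assumes "c \<noteq> 0" "c' \<noteq> 0"
  shows "weyl c u v ** weyl c' u' v' = weyl c' u' v' ** weyl c u v \<longleftrightarrow> bit_dot v u' = bit_dot v' u"
  using assms by (simp add: weyl_mult_weyl weyl_eq_iff add.commute[of u'] add.commute[of v'] bit_sign_eq_iff mult.commute)

text \<open>The equation \<open>c ^ 4 = 1\<close> is stable under products without exhibiting
  exponents. It splits into linear factors with roots 1, -1, \<open>\<i>\<close> and
  \<open>- \<i>\<close>.\<close>

lemma power4_eq_1_iff: "(c::complex) ^ 4 = 1 \<longleftrightarrow> (\<exists>m. c = \<i> ^ m)"
proof
  assume c: "c ^ 4 = 1"
  have "(c - 1) * (c + 1) * ((c - \<i>) * (c + \<i>)) = c ^ 4 - 1"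
    by (simp add: algebra_simps eval_nat_numeral)
  then have "c = \<i> ^ 0 \<or> c = \<i> ^ 2 \<or> c = \<i> ^ 1 \<or> c = \<i> ^ 3"
    using c by (auto simp: eval_nat_numeral eq_neg_iff_add_eq_0)
  then show "\<exists>m. c = \<i> ^ m" by blast
next
  assume "\<exists>m. c = \<i> ^ m"
  then obtain m where "c = \<i> ^ m" by blast
  then have "c ^ 4 = (\<i> ^ 4) ^ m" by (simp flip: power_mult add: mult.commute)
  then show "c ^ 4 = 1" by simp
qed

lemma power_power4: "c ^ 4 = 1 \<Longrightarrow> (c ^ m) ^ 4 = (1::complex)"
  by (simp only: power_mult[symmetric] mult.commute[of m]) (simp only: power_mult power_one)

lemma bit_sign_power4 [simp]: "bit_sign b ^ 4 = 1"
  by (cases b) auto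

lemma pauli1_weyl1_form:
  assumes "P \<in> pauli1"
  shows "\<exists>c a b. c ^ 4 = 1 \<and> P = weyl1 c a b"
proof -
  have "(1::complex) ^ 4 = 1" "\<i> ^ 4 = 1" by simp_all
  then show ?thesis
    using assms
    unfolding pauli1_def mat_1_eq_weyl1 sigma_x_eq_weyl1 sigma_z_eq_weyl1 sigma_y_eq_weyl1
    by blast
qed

lemma weyl1_pauli1: "\<exists>c. c ^ 4 = 1 \<and> weyl1 c a b \<in> pauli1"
  unfolding pauli1_def mat_1_eq_weyl1 sigma_x_eq_weyl1 sigma_z_eq_weyl1 sigma_y_eq_weyl1
  by (cases a; cases b) ((rule exI[of _ 1], simp; fail) | (rule exI[of _ \<i>], simp))+

lemma pauli_ops_eq: "(pauli_ops :: 'n::finite operator set) = {weyl c u v | c u v. c ^ 4 = 1}"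
proof (intro Set.set_eqI iffI)
  fix A :: "'n operator" assume "A \<in> pauli_ops"
  then obtain m P where A: "A = mat (\<i> ^ m) ** tensor P" "\<And>q. P q \<in> pauli1"
    by (auto simp: pauli_ops_def)
  have "\<forall>q. \<exists>c a b. c ^ 4 = 1 \<and> P q = weyl1 c a b"
    using A(2) pauli1_weyl1_form by blast
  then obtain c a b where P: "\<And>q. c q ^ 4 = 1" "\<And>q. P q = weyl1 (c q) (a q) (b q)"
    by metis
  have "tensor P = weyl (\<Prod>q\<in>UNIV. c q) (\<chi> q. a q) (\<chi> q. b q)"
    unfolding tensor_weyl1[symmetric] by (rule arg_cong[of _ _ tensor]) (simp add: P(2) fun_eq_iff)
  then have "A = weyl (\<i> ^ m * (\<Prod>q\<in>UNIV. c q)) (\<chi> q. a q) (\<chi> q. b q)"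
    by (simp add: A(1) mat_eq_weyl weyl_mult_weyl)
  moreover have "(\<i> ^ m * (\<Prod>q\<in>UNIV. c q)) ^ 4 = 1"
    using P(1) power4_eq_1_iff[of "\<i> ^ m"] by (auto simp: power_mult_distrib prod_power_distrib)
  ultimately show "A \<in> {weyl c u v | c u v. c ^ 4 = 1}"
    by blast
next
  fix A :: "'n operator" assume "A \<in> {weyl c u v | c u v. c ^ 4 = 1}"
  then obtain c u v where A: "A = weyl c u v" "c ^ 4 = 1" by auto
  \<comment> \<open>\<open>f a b\<close> is a scalar that turns \<open>X^a Z^b\<close> into a Pauli
    matrix. These scalars multiply to \<open>p\<close>, whose inverse is \<open>p ^ 3\<close>, so
    the missing prefactor is \<open>c * p ^ 3\<close>.\<close>
  obtain f where f: "\<And>a b. f a b ^ 4 = 1" "\<And>a b. weyl1 (f a b) a b \<in> pauli1"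
    using weyl1_pauli1 by metis
  define p where "p = (\<Prod>q\<in>UNIV. f (u $ q) (v $ q))"
  have p: "p ^ 4 = 1" by (simp add: p_def f prod_power_distrib)
  then have "(c * p ^ 3) ^ 4 = 1" by (simp only: A power_mult_distrib power_power4 mult_1)
  then obtain m where m: "c * p ^ 3 = \<i> ^ m" using power4_eq_1_iff by blast
  have "A = mat (\<i> ^ m) ** tensor (\<lambda>q. weyl1 (f (u $ q) (v $ q)) (u $ q) (v $ q))"
    unfolding tensor_weyl1 mat_eq_weyl weyl_mult_weyl A p_def[symmetric] m[symmetric]
    using p by (simp add: weyl_eq_iff mult.assoc flip: power_Suc2)
  then show "A \<in> pauli_ops" using f unfolding pauli_ops_def by blast
qed

lemma weyl_in_pauli_ops: "c ^ 4 = 1 \<Longrightarrow> weyl c u v \<in> pauli_ops"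
  by (auto simp: pauli_ops_eq)

text \<open>\<open>c ^ 3\<close> inverts \<open>c\<close>, and the extra sign cancels the one from
  moving \<open>Z^v\<close> past \<open>X^u\<close>.\<close>

lemma weyl_inverse: "c ^ 4 = 1 \<Longrightarrow> weyl (c ^ 3 * bit_sign (bit_dot v u)) u v ** weyl c u v = mat 1"
  by (simp add: weyl_mult_weyl mat_eq_weyl weyl_eq_iff) (simp add: eval_nat_numeral algebra_simps)

section \<open>The Pauli group and its subgroups\<close>

lemma group_pauli_group: "group (pauli_group :: 'n::finite operator monoid)"
proof (rule groupI)
  show "\<one>\<^bsub>pauli_group\<^esub> \<in> carrier (pauli_group :: 'n operator monoid)"
    by (simp add: pauli_group_def mat_eq_weyl weyl_in_pauli_ops)
next
  fix A B :: "'n operator" assume "A \<in> carrier pauli_group" "B \<in> carrier pauli_group"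
  then show "A \<otimes>\<^bsub>pauli_group\<^esub> B \<in> carrier pauli_group"
    by (auto simp: pauli_group_def pauli_ops_eq weyl_mult_weyl power_mult_distrib)
      (metis bit_sign_power4 mult_1 power_mult_distrib)
next
  fix A :: "'n operator" assume "A \<in> carrier pauli_group"
  then obtain c u v where A: "A = weyl c u v" "c ^ 4 = 1" by (auto simp: pauli_group_def pauli_ops_eq)
  have "weyl (c ^ 3 * bit_sign (bit_dot v u)) u v ** A = mat 1"
    unfolding A(1) using A(2) by (rule weyl_inverse)
  moreover have "(c ^ 3 * bit_sign (bit_dot v u)) ^ 4 = 1"
    using A by (simp only: power_mult_distrib power_power4 bit_sign_power4 mult_1)
  ultimately show "\<exists>B\<in>carrier pauli_group. B \<otimes>\<^bsub>pauli_group\<^esub> A = \<one>\<^bsub>pauli_group\<^esub>"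
    by (auto simp: pauli_group_def intro: weyl_in_pauli_ops)
qed (auto simp: pauli_group_def matrix_mul_assoc)

lemma pauli_subgroupI:
  fixes A :: "'n::finite operator set"
  assumes "A \<subseteq> pauli_ops" "mat 1 \<in> A" "\<And>P Q. P \<in> A \<Longrightarrow> Q \<in> A \<Longrightarrow> P ** Q \<in> A"
    and inv: "\<And>P. P \<in> A \<Longrightarrow> \<exists>Q\<in>A. Q ** P = mat 1"
  shows "subgroup A pauli_group"
proof (rule group.subgroupI[OF group_pauli_group])
  fix P assume P: "P \<in> A"
  then obtain Q where "Q \<in> A" "Q ** P = mat 1" using inv by blast
  then have "inv\<^bsub>pauli_group\<^esub> P = Q"
    using P assms(1) by (intro group.inv_equality[OF group_pauli_group]) (auto simp: pauli_group_def)
  then show "inv\<^bsub>pauli_group\<^esub> P \<in> A" using \<open>Q \<in> A\<close> by simp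
qed (use assms in \<open>auto simp: pauli_group_def\<close>)

lemma subgroup_mult_closed:
  assumes "subgroup G pauli_group" "P \<in> G" "Q \<in> G"
  shows "P ** Q \<in> G"
  using subgroup.m_closed[OF assms] by (simp add: pauli_group_def)

text \<open>Products of X-type operators add their supports, and over bits an additive subgroup is a
  subspace. Membership in a group thus extends from generators to their span.\<close>

lemma subspace_x_part:
  assumes "subgroup G pauli_group"
  shows "vec.subspace {u. weyl 1 u 0 \<in> G}"
proof (rule bit_subspaceI)
  show "0 \<in> {u. weyl 1 u 0 \<in> G}"
    using subgroup.one_closed[OF assms] by (simp add: pauli_group_def mat_eq_weyl)
next
  fix u v :: "bit ^ 'a" assume "u \<in> {u. weyl 1 u 0 \<in> G}" "v \<in> {u. weyl 1 u 0 \<in> G}"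
  then have "weyl 1 u 0 ** weyl 1 v 0 \<in> G" by (simp add: subgroup_mult_closed[OF assms])
  then show "u + v \<in> {u. weyl 1 u 0 \<in> G}" by (simp add: weyl_mult_weyl)
qed

lemma subspace_z_part:
  assumes "subgroup G pauli_group"
  shows "vec.subspace {v. weyl 1 0 v \<in> G}"
proof (rule bit_subspaceI)
  show "0 \<in> {v. weyl 1 0 v \<in> G}"
    using subgroup.one_closed[OF assms] by (simp add: pauli_group_def mat_eq_weyl)
next
  fix u v :: "bit ^ 'a" assume "u \<in> {v. weyl 1 0 v \<in> G}" "v \<in> {v. weyl 1 0 v \<in> G}"
  then have "weyl 1 0 u ** weyl 1 0 v \<in> G" by (simp add: subgroup_mult_closed[OF assms])
  then show "u + v \<in> {v. weyl 1 0 v \<in> G}" by (simp add: weyl_mult_weyl)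
qed

section \<open>Stabilizer and centralizer of a CSS code\<close>

definition css_stabilizer :: "(bit ^ 'n) set \<Rightarrow> 'n::finite operator set" where
  "css_stabilizer C = {weyl 1 g h | g h. g \<in> C \<and> h \<in> C}"

lemma css_stabilizerI: "g \<in> C \<Longrightarrow> h \<in> C \<Longrightarrow> weyl 1 g h \<in> css_stabilizer C"
  by (auto simp: css_stabilizer_def)

lemma css_stabilizerE:
  assumes "P \<in> css_stabilizer C"
  obtains g h where "P = weyl 1 g h" "g \<in> C" "h \<in> C"
  using assms by (auto simp: css_stabilizer_def)

text \<open>Self-orthogonality of \<open>C\<close> makes every sign in a product trivial, so the
  scalar stays 1 and each element is its own inverse.\<close>

lemma subgroup_css_stabilizer:
  assumes C: "vec.subspace C" "C \<subseteq> dual_code C"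
  shows "subgroup (css_stabilizer C) pauli_group"
proof -
  have orth: "bit_dot g h = 0" if "g \<in> C" "h \<in> C" for g h
    using C(2) that by (auto simp: dual_code_def)
  show ?thesis
  proof (rule pauli_subgroupI)
    show "css_stabilizer C \<subseteq> pauli_ops"
      by (auto simp: css_stabilizer_def intro!: weyl_in_pauli_ops)
    show "mat 1 \<in> css_stabilizer C"
      using vec.subspace_0[OF C(1)] by (auto simp: css_stabilizer_def mat_eq_weyl)
    show "P ** Q \<in> css_stabilizer C" if PQ: "P \<in> css_stabilizer C" "Q \<in> css_stabilizer C" for P Q
    proof -
      obtain g h g' h' where "P = weyl 1 g h" "Q = weyl 1 g' h'" and mem: "g \<in> C" "h \<in> C" "g' \<in> C" "h' \<in> C"
        using PQ unfolding css_stabilizer_def by blast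
      then have "P ** Q = weyl 1 (g + g') (h + h')" by (simp add: weyl_mult_weyl orth)
      then show ?thesis using mem vec.subspace_add[OF C(1)] by (auto simp: css_stabilizer_def)
    qed
    show "\<exists>Q\<in>css_stabilizer C. Q ** P = mat 1" if "P \<in> css_stabilizer C" for P
      using that by (intro bexI[of _ P]) (auto simp: css_stabilizer_def mat_eq_weyl weyl_mult_weyl orth)
  qed
qed

text \<open>The explicit set is a subgroup containing the generators. Conversely, the X-part and the
  Z-part of the generated group are subspaces containing the rows of \<open>H\<close>, hence
  \<open>C\<close>.\<close>

lemma stabilizer_eq_css_stabilizer:
  fixes H :: "nat \<Rightarrow> bit ^ 'n::finite" and r :: nat
  defines "C \<equiv> vec.span (H ` {1..r})"
  assumes C: "C \<subseteq> dual_code C"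
  shows "stabilizer r H = css_stabilizer C"
proof
  let ?gens = "x_type ` H ` {1..r} \<union> z_type ` H ` {1..r}"
  have sub: "vec.subspace C" unfolding C_def by (rule vec.subspace_span)
  have row: "H i \<in> C" if "i \<in> {1..r}" for i
    unfolding C_def using that by (intro vec.span_base) blast
  show "stabilizer r H \<subseteq> css_stabilizer C"
    unfolding stabilizer_def
    by (rule group.generate_subgroup_incl[OF group_pauli_group _ subgroup_css_stabilizer[OF sub C]])
      (use row vec.subspace_0[OF sub] in \<open>auto simp: x_type_eq_weyl z_type_eq_weyl intro!: css_stabilizerI\<close>)
  have "?gens \<subseteq> carrier pauli_group"
    by (auto simp: pauli_group_def x_type_eq_weyl z_type_eq_weyl intro!: weyl_in_pauli_ops)
  then have G: "subgroup (stabilizer r H) pauli_group"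
    unfolding stabilizer_def by (rule group.generate_is_subgroup[OF group_pauli_group])
  have "C \<subseteq> {u. weyl 1 u 0 \<in> stabilizer r H}"
    unfolding C_def
    by (rule vec.span_minimal[OF _ subspace_x_part[OF G]])
      (auto simp: stabilizer_def x_type_eq_weyl[symmetric] intro: generate.incl)
  moreover have "C \<subseteq> {u. weyl 1 0 u \<in> stabilizer r H}"
    unfolding C_def
    by (rule vec.span_minimal[OF _ subspace_z_part[OF G]])
      (auto simp: stabilizer_def z_type_eq_weyl[symmetric] intro: generate.incl)
  ultimately show "css_stabilizer C \<subseteq> stabilizer r H"
    using subgroup_mult_closed[OF G, of "weyl 1 _ 0" "weyl 1 0 _"]
    by (auto simp: css_stabilizer_def weyl_mult_weyl)
qed

text \<open>Commuting with \<open>weyl 1 g h\<close> is one equation in \<open>g\<close> and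
  \<open>h\<close>; setting either of them to 0 separates it into the two orthogonality
  conditions.\<close>

lemma centralizer_css_stabilizer:
  assumes C: "vec.subspace C"
  shows "centralizer (css_stabilizer C)
    = {weyl c u v | c u v. c ^ 4 = 1 \<and> u \<in> dual_code C \<and> v \<in> dual_code C}"
proof (intro Set.set_eqI iffI)
  fix P assume P: "P \<in> centralizer (css_stabilizer C)"
  then obtain c u v where P_eq: "P = weyl c u v" "c ^ 4 = 1"
    by (auto simp: centralizer_def pauli_ops_eq)
  then have [simp]: "c \<noteq> 0" by auto
  have comm: "bit_dot v g = bit_dot h u" if "g \<in> C" "h \<in> C" for g h
  proof -
    have "weyl c u v ** weyl 1 g h = weyl 1 g h ** weyl c u v"
      using P P_eq that by (auto simp: centralizer_def css_stabilizer_def)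
    then show ?thesis by (simp add: weyl_commute_iff)
  qed
  have "bit_dot v g = 0" "bit_dot u g = 0" if "g \<in> C" for g
    using comm[OF that vec.subspace_0[OF C]] comm[OF vec.subspace_0[OF C] that]
    by (simp_all add: bit_dot_commute)
  then show "P \<in> {weyl c u v | c u v. c ^ 4 = 1 \<and> u \<in> dual_code C \<and> v \<in> dual_code C}"
    using P_eq unfolding dual_code_def by blast
next
  fix P assume "P \<in> {weyl c u v | c u v. c ^ 4 = 1 \<and> u \<in> dual_code C \<and> v \<in> dual_code C}"
  then obtain c u v where P: "P = weyl c u v" "c ^ 4 = 1" "u \<in> dual_code C" "v \<in> dual_code C"
    by auto
  then have [simp]: "c \<noteq> 0" by auto
  have "bit_dot v g = 0" "bit_dot h u = 0" if "g \<in> C" "h \<in> C" for g h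
    using P that by (simp_all add: dual_code_def bit_dot_commute[of h])
  then show "P \<in> centralizer (css_stabilizer C)"
    using P by (auto simp: centralizer_def css_stabilizer_def weyl_in_pauli_ops weyl_commute_iff)
qed

section \<open>Transversal gates\<close>

lemma tensor_hadamard:
  "tensor (\<lambda>_. hadamard) $ x $ (y::bit ^ 'n::finite) = bit_sign (bit_dot x y) / complex_of_real (sqrt 2) ^ CARD('n)"
proof -
  have "hadamard $ a $ b = bit_sign (a * b) / complex_of_real (sqrt 2)" for a b
    by (cases a; cases b) (simp_all add: hadamard_def)
  then show ?thesis
    by (simp add: tensor_def bit_dot_def bit_sign_sum prod_dividef)
qed

text \<open>The matrix entries are normalised characters, so this is \<open>character_sum\<close>
  over the whole space.\<close>

lemma tensor_hadamard_unitary: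
  "tensor (\<lambda>_. hadamard) ** dagger (tensor (\<lambda>_. hadamard)) = (mat 1 :: 'n::finite operator)"
proof -
  have sqrt2: "complex_of_real (sqrt 2) ^ m * complex_of_real (sqrt 2) ^ m = 2 ^ m" for m
    by (simp flip: power_mult_distrib of_real_mult)
  have "(tensor (\<lambda>_. hadamard) ** dagger (tensor (\<lambda>_. hadamard))) $ x $ y = (mat 1 :: 'n operator) $ x $ y" for x y
  proof -
    have "(tensor (\<lambda>_. hadamard) ** dagger (tensor (\<lambda>_. hadamard))) $ x $ y
        = (\<Sum>z\<in>UNIV. bit_sign (bit_dot (x + y) z)) / 2 ^ CARD('n)"
      by (simp add: matrix_matrix_mult_def dagger_def tensor_hadamard bit_dot_add_left bit_sign_add
          sqrt2 sum_divide_distrib)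
    also have "\<dots> = (mat 1 :: 'n operator) $ x $ y"
      by (simp add: character_sum[OF vec.subspace_UNIV] dual_code_UNIV mat_def bit_vec_add_eq_0_iff)
    finally show ?thesis .
  qed
  then show ?thesis by (simp add: vec_eq_iff)
qed

text \<open>Conjugation exchanges X and Z; the sign comes from reordering
  \<open>Z^g X^h\<close>.\<close>

lemma tensor_hadamard_weyl:
  "tensor (\<lambda>_. hadamard) ** weyl 1 g h = weyl (bit_sign (bit_dot g h)) h g ** tensor (\<lambda>_. hadamard)"
  by (simp add: vec_eq_iff weyl_mult_left weyl_mult_right tensor_hadamard bit_dot_add_left
      bit_dot_add_right bit_sign_add bit_dot_commute algebra_simps)

section \<open>Transversal phase gates and their diagonal entries\<close>

definition phase :: "('n \<Rightarrow> int) \<Rightarrow> bit ^ 'n::finite \<Rightarrow> complex" where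
  "phase b x = (\<Prod>q\<in>UNIV. if x $ q = 0 then 1 else \<i> powi b q)"

lemma tensor_phase_gate_pow:
  "tensor (\<lambda>q. phase_gate_pow (b q)) = (\<chi> x y. if x = y then phase b x else 0)"
proof -
  have "(\<Prod>q\<in>UNIV. phase_gate_pow (b q) $ (x $ q) $ (y $ q)) = (if x = y then phase b x else 0)" for x y
  proof (cases "x = y")
    case True
    then show ?thesis by (simp add: phase_gate_pow_def phase_def)
  next
    case False
    then obtain q where "x $ q \<noteq> y $ q" by (auto simp: vec_eq_iff)
    then have "phase_gate_pow (b q) $ (x $ q) $ (y $ q) = 0" by (simp add: phase_gate_pow_def)
    then have "(\<Prod>q\<in>UNIV. phase_gate_pow (b q) $ (x $ q) $ (y $ q)) = 0"
      by (intro prod_zero[OF finite_class.finite_UNIV]) blast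
    then show ?thesis using False by simp
  qed
  then show ?thesis by (simp add: tensor_def)
qed

lemma phase_gate_mult_left: "(tensor (\<lambda>q. phase_gate_pow (b q)) ** A) $ x $ y = phase b x * A $ x $ y"
proof -
  have "(tensor (\<lambda>q. phase_gate_pow (b q)) ** A) $ x $ y
      = (\<Sum>k\<in>UNIV. if x = k then phase b x * A $ k $ y else 0)"
    unfolding matrix_matrix_mult_def tensor_phase_gate_pow
    by (simp add: if_distrib[of "\<lambda>a. a * _"] cong: if_cong)
  then show ?thesis by simp
qed

lemma phase_gate_mult_right: "(A ** tensor (\<lambda>q. phase_gate_pow (b q))) $ x $ y = A $ x $ y * phase b y"
proof -
  have "(A ** tensor (\<lambda>q. phase_gate_pow (b q))) $ x $ y
      = (\<Sum>k\<in>UNIV. if k = y then A $ x $ k * phase b k else 0)"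
    unfolding matrix_matrix_mult_def tensor_phase_gate_pow
    by (simp add: if_distrib[of "\<lambda>a. _ * a"] cong: if_cong)
  then show ?thesis by simp
qed

lemma phase_0 [simp]: "phase b 0 = 1"
  by (simp add: phase_def)

lemma ipowi_cases:
  assumes "range b \<subseteq> {-1, 1}"
  shows "\<i> powi b q = \<i> \<or> \<i> powi b q = - \<i>"
proof -
  have "b q \<in> {-1, 1}" using assms by blast
  then show ?thesis by (auto simp: power_int_minus)
qed

text \<open>Qubit by qubit, the only case of interest is that both bits are 1: the two factors
  multiply to -1, and the sign restores 1.\<close>

lemma phase_add:
  assumes "range b \<subseteq> {-1, 1}"
  shows "phase b (x + y) = phase b x * phase b y * bit_sign (bit_dot x y)"
proof -
  have "(if (x + y) $ q = 0 then 1 else \<i> powi b q)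
      = (if x $ q = 0 then 1 else \<i> powi b q) * (if y $ q = 0 then 1 else \<i> powi b q) * bit_sign (x $ q * y $ q)" for q
    using ipowi_cases[OF assms, of q] by (cases "x $ q"; cases "y $ q") auto
  then show ?thesis by (simp add: phase_def bit_dot_def bit_sign_sum prod.distrib)
qed

lemma phase_cnj:
  assumes "range b \<subseteq> {-1, 1}"
  shows "phase b x * cnj (phase b x) = 1"
proof -
  have "(if x $ q = 0 then 1 else \<i> powi b q) * cnj (if x $ q = 0 then 1 else \<i> powi b q) = 1" for q
    using ipowi_cases[OF assms, of q] by (cases "x $ q") (auto simp del: complex_cnj_power_int)
  then show ?thesis by (simp add: phase_def flip: prod.distrib)
qed

lemma phase_gate_unitary:
  assumes "range b \<subseteq> {-1, 1}"
  shows "tensor (\<lambda>q. phase_gate_pow (b q)) ** dagger (tensor (\<lambda>q. phase_gate_pow (b q))) = mat 1"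
proof -
  have "(tensor (\<lambda>q. phase_gate_pow (b q)) ** dagger (tensor (\<lambda>q. phase_gate_pow (b q)))) $ x $ y = mat 1 $ x $ y" for x y
    unfolding phase_gate_mult_left
    using phase_cnj[OF assms] by (simp add: dagger_def tensor_phase_gate_pow mat_def)
  then show ?thesis by (simp add: vec_eq_iff)
qed

text \<open>Comparing the phases at \<open>y\<close> and \<open>y + g\<close> by
  \<open>phase_add\<close> yields the constant \<open>phase b g\<close> and a sign in
  \<open>y\<close> that acts as an extra \<open>Z^g\<close>.\<close>

lemma phase_gate_weyl:
  assumes "range b \<subseteq> {-1, 1}"
  shows "tensor (\<lambda>q. phase_gate_pow (b q)) ** weyl 1 g h
    = weyl (phase b g) g (g + h) ** tensor (\<lambda>q. phase_gate_pow (b q))"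
proof -
  have "(tensor (\<lambda>q. phase_gate_pow (b q)) ** weyl 1 g h) $ x $ y
      = (weyl (phase b g) g (g + h) ** tensor (\<lambda>q. phase_gate_pow (b q))) $ x $ y" for x y
    unfolding phase_gate_mult_left phase_gate_mult_right
    by (simp add: weyl_def phase_add[OF assms] bit_dot_add_left bit_sign_add bit_dot_commute[of y])
  then show ?thesis by (simp add: vec_eq_iff)
qed

lemma phase_sign_twist:
  "phase (\<lambda>q. if c $ q = 0 then 1 else - 1) x = phase (\<lambda>_. 1) x * bit_sign (bit_dot c x)"
proof -
  have "(if x $ q = 0 then 1 else \<i> powi (if c $ q = 0 then 1 else - 1))
      = (if x $ q = 0 then 1 else \<i> powi 1) * bit_sign (c $ q * x $ q)" for q
    by (cases "x $ q"; cases "c $ q") (auto simp: power_int_minus)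
  then show ?thesis by (simp add: phase_def bit_dot_def bit_sign_sum prod.distrib)
qed

text \<open>On the stabilizer, conjugation by the transversal gates exchanges \<open>g\<close> and
  \<open>h\<close> or replaces \<open>h\<close> by \<open>g + h\<close>. Both are involutions, so
  stability suffices for invariance.\<close>

lemma involution_image:
  assumes "\<And>s. s \<in> S \<Longrightarrow> f s \<in> S" "\<And>s. s \<in> S \<Longrightarrow> f (f s) = s"
  shows "f ` S = S"
proof
  show "f ` S \<subseteq> S" using assms(1) by blast
  show "S \<subseteq> f ` S"
  proof
    fix s assume "s \<in> S"
    then show "s \<in> f ` S" using assms by (intro image_eqI[of _ _ "f s"]) auto
  qed
qed

section \<open>Encoder and logical gates\<close>

text \<open>The \<open>u j\<close> represent an orthonormal basis of the quotient of
  \<open>dual_code C\<close> by \<open>C\<close>; \<open>u_complete\<close> says that they span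
  it.\<close>

locale logical_vectors =
  fixes C :: "(bit ^ 'n::finite) set" and u :: "'k::finite \<Rightarrow> bit ^ 'n" and r :: nat
  assumes subspace_C: "vec.subspace C" and C_subset: "C \<subseteq> dual_code C" and card_C: "card C = 2 ^ r"
    and card_k: "CARD('k) + 2 * r = CARD('n)"
    and u_dual: "u j \<in> dual_code C"
    and u_orthonormal: "bit_dot (u i) (u j) = (if i = j then 1 else 0)"
    and u_complete: "x \<in> dual_code C \<Longrightarrow> (\<And>j. bit_dot (u j) x = 0) \<Longrightarrow> x \<in> C"
begin

section \<open>The encoding map and coordinates modulo \<open>C\<close>\<close>

definition enc :: "bit ^ 'k \<Rightarrow> bit ^ 'n" where
  "enc y = (\<Sum>j\<in>UNIV. y $ j *s u j)"

definition coord :: "bit ^ 'n \<Rightarrow> bit ^ 'k" where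
  "coord x = (\<chi> j. bit_dot (u j) x)"

lemma enc_add: "enc (x + y) = enc x + enc y"
  by (simp add: enc_def sum.distrib vec.scale_left_distrib)

lemma enc_axis: "enc (axis j 1) = u j"
proof -
  have "enc (axis j 1) = (\<Sum>i\<in>UNIV. if i = j then u i else 0)"
    unfolding enc_def by (rule sum.cong) (auto simp: axis_def)
  then show ?thesis by simp
qed

lemma enc_in_dual: "enc y \<in> dual_code C"
  unfolding enc_def
  by (intro vec.subspace_sum vec.subspace_scale subspace_dual_code u_dual)

text \<open>Adjointness of \<open>enc\<close> and \<open>coord\<close>, which turns the physical
  Hadamard sign into the logical one.\<close>

lemma bit_dot_enc: "bit_dot x (enc y) = bit_dot (coord x) y"
  unfolding bit_dot_def[of "coord x"]
  by (simp add: enc_def bit_dot_sum_right bit_dot_scale_right coord_def bit_dot_commute[of x] mult.commute)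

lemma coord_add: "coord (x + y) = coord x + coord y"
  by (simp add: coord_def vec_eq_iff bit_dot_add_right)

lemma coord_enc: "coord (enc y) = y"
proof -
  have "coord (u j) = axis j 1" for j
    by (simp add: coord_def axis_def vec_eq_iff u_orthonormal)
  then have "coord (enc y) $ i = y $ i" for i
    by (simp add: coord_def[of "enc y"] bit_dot_enc bit_dot_axis_left)
  then show ?thesis by (simp add: vec_eq_iff)
qed

lemma coord_C: "g \<in> C \<Longrightarrow> coord g = 0"
  using u_dual by (simp add: coord_def vec_eq_iff dual_code_def)

text \<open>Passes between two descriptions of the support of the encoder: by cosets for sums along
  columns, by coordinates for sums along rows.\<close>

lemma add_enc_in_C_iff: "x + enc y \<in> C \<longleftrightarrow> x \<in> dual_code C \<and> coord x = y"
proof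
  assume C: "x + enc y \<in> C"
  then have "x + enc y \<in> dual_code C" using C_subset by blast
  then have "(x + enc y) + enc y \<in> dual_code C"
    using enc_in_dual vec.subspace_add[OF subspace_dual_code] by blast
  moreover have "coord x + y = 0"
    using coord_C[OF C] by (simp add: coord_add coord_enc)
  ultimately show "x \<in> dual_code C \<and> coord x = y"
    by (simp add: add.assoc bit_vec_add_eq_0_iff)
next
  assume x: "x \<in> dual_code C \<and> coord x = y"
  then have "coord (x + enc y) $ j = 0" for j by (simp add: coord_add coord_enc)
  then have "bit_dot (u j) (x + enc y) = 0" for j by (simp add: coord_def)
  then show "x + enc y \<in> C"
    using x enc_in_dual vec.subspace_add[OF subspace_dual_code, of x C "enc y"]
    by (intro u_complete) auto
qed

section \<open>The encoder as an isometry onto the code space\<close>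

definition amp :: complex where
  "amp = 1 / complex_of_real (sqrt 2) ^ r"

lemma amp_nonzero: "amp \<noteq> 0"
  by (simp add: amp_def)

lemma cnj_amp: "cnj amp = amp"
  by (simp add: amp_def)

lemma amp_square: "amp * (2 ^ r * amp) = 1"
proof -
  have "complex_of_real (sqrt 2) ^ r * complex_of_real (sqrt 2) ^ r = 2 ^ r"
    by (simp flip: power_mult_distrib of_real_mult)
  then show ?thesis by (simp add: amp_def field_simps)
qed

text \<open>The basis state \<open>y\<close> is encoded as the uniform superposition of the coset \<open>enc y + C\<close>.\<close>

definition V :: "complex ^ (bit ^ 'k) ^ (bit ^ 'n)" where
  "V = (\<chi> x y. if x + enc y \<in> C then amp else 0)"

lemma V_nth: "V $ x $ y = (if x \<in> dual_code C \<and> coord x = y then amp else 0)"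
  by (simp add: V_def add_enc_in_C_iff)

lemma sum_V_column: "(\<Sum>x\<in>UNIV. f x * V $ x $ y) = (\<Sum>g\<in>C. f (g + enc y)) * amp"
proof -
  have "(\<Sum>x\<in>UNIV. f x * V $ x $ y) = (\<Sum>x\<in>UNIV. f (x + enc y) * V $ (x + enc y) $ y)"
    by (rule sum_subspace_translate[OF vec.subspace_UNIV UNIV_I, symmetric])
  also have "\<dots> = (\<Sum>x\<in>UNIV. if x \<in> C then f (x + enc y) * amp else 0)"
    by (rule sum.cong) (auto simp: V_def add.assoc)
  also have "\<dots> = (\<Sum>g\<in>C. f (g + enc y)) * amp"
    by (simp add: sum_distrib_right flip: sum.inter_filter)
  finally show ?thesis .
qed

lemma sum_V_row: "(\<Sum>y\<in>UNIV. V $ x $ y * f y) = (if x \<in> dual_code C then amp * f (coord x) else 0)"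
proof -
  have "(\<Sum>y\<in>UNIV. V $ x $ y * f y)
      = (\<Sum>y\<in>UNIV. if coord x = y then (if x \<in> dual_code C then amp * f y else 0) else 0)"
    by (rule sum.cong) (auto simp: V_nth)
  then show ?thesis by simp
qed

text \<open>Distinct columns live on disjoint cosets. Each coset has 2^r elements, and
  \<open>amp\<close> is the inverse square root of that number.\<close>

lemma V_isometry: "dagger V ** V = mat 1"
proof -
  have "(dagger V ** V) $ y $ y' = mat 1 $ y $ y'" for y y'
  proof -
    have "(dagger V ** V) $ y $ y' = (\<Sum>g\<in>C. cnj (V $ (g + enc y') $ y)) * amp"
      by (simp add: matrix_matrix_mult_def dagger_def sum_V_column)
    also have "(\<Sum>g\<in>C. cnj (V $ (g + enc y') $ y)) = (\<Sum>g\<in>C. if y = y' then amp else 0)"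
    proof (rule sum.cong)
      fix g assume g: "g \<in> C"
      then have "g + enc y' \<in> dual_code C"
        using C_subset enc_in_dual vec.subspace_add[OF subspace_dual_code] by blast
      then show "cnj (V $ (g + enc y') $ y) = (if y = y' then amp else 0)"
        using g by (auto simp: V_nth coord_add coord_C coord_enc cnj_amp)
    qed simp
    also have "\<dots> * amp = mat 1 $ y $ y'"
      using amp_square by (simp add: card_C mat_def mult_ac)
    finally show ?thesis .
  qed
  then show ?thesis by (simp add: vec_eq_iff)
qed

lemma V_vector: "(V *v \<phi>) $ x = (if x \<in> dual_code C then amp * \<phi> $ coord x else 0)"
  by (simp add: matrix_vector_mult_def sum_V_row)

text \<open>Invariance under Z-type stabilizers confines a state to \<open>dual_code C\<close>, and
  invariance under X-type ones makes it constant on cosets of \<open>C\<close>. Its values at the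
  points \<open>enc y\<close>, divided by \<open>amp\<close>, then give a preimage.\<close>

lemma range_V: "range ((*v) V) = code_space (css_stabilizer C)"
proof (intro Set.set_eqI iffI)
  fix \<psi> assume "\<psi> \<in> range ((*v) V)"
  then obtain \<phi> where \<psi>: "\<psi> = V *v \<phi>" by auto
  have "(weyl 1 g h *v \<psi>) $ x = \<psi> $ x" if gh: "g \<in> C" "h \<in> C" for g h x
  proof -
    have g: "g \<in> dual_code C" using gh C_subset by blast
    have mem: "x + g \<in> dual_code C \<longleftrightarrow> x \<in> dual_code C"
      using vec.subspace_add[OF subspace_dual_code _ g, of x] vec.subspace_add[OF subspace_dual_code _ g, of "x + g"]
      by (auto simp: add.assoc)
    have "bit_dot h (x + g) = 0" if "x \<in> dual_code C"
      using that mem gh by (simp add: dual_code_def bit_dot_commute[of h])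
    then show ?thesis
      by (simp add: weyl_vector \<psi> V_vector mem coord_add coord_C gh)
  qed
  then have "weyl 1 g h *v \<psi> = \<psi>" if "g \<in> C" "h \<in> C" for g h
    using that by (simp add: vec_eq_iff)
  then show "\<psi> \<in> code_space (css_stabilizer C)"
    by (auto simp: code_space_def css_stabilizer_def)
next
  fix \<psi> assume "\<psi> \<in> code_space (css_stabilizer C)"
  then have inv: "weyl 1 g h *v \<psi> = \<psi>" if "g \<in> C" "h \<in> C" for g h
    using that by (auto simp: code_space_def intro: css_stabilizerI)
  have "(V *v (\<chi> y. \<psi> $ enc y / amp)) $ x = \<psi> $ x" for x
  proof (cases "x \<in> dual_code C")
    case True
    then have "x + enc (coord x) \<in> C" by (simp add: add_enc_in_C_iff)
    then have "(weyl 1 (x + enc (coord x)) 0 *v \<psi>) $ x = \<psi> $ x"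
      using inv vec.subspace_0[OF subspace_C] by simp
    then show ?thesis using True by (simp add: V_vector weyl_vector amp_nonzero)
  next
    case False
    then obtain h where h: "h \<in> C" "bit_dot h x = 1"
      by (auto simp: dual_code_def bit_dot_commute)
    then have "(weyl 1 0 h *v \<psi>) $ x = \<psi> $ x"
      using inv vec.subspace_0[OF subspace_C] by simp
    then have "\<psi> $ x = 0" using h by (simp add: weyl_vector)
    then show ?thesis using False by (simp add: V_vector)
  qed
  then show "\<psi> \<in> range ((*v) V)" by (intro range_eqI[of _ _ "\<chi> y. \<psi> $ enc y / amp"]) (simp add: vec_eq_iff)
qed

abbreviation Xb :: "'k \<Rightarrow> 'n operator" where "Xb j \<equiv> weyl 1 (u j) 0"

abbreviation Zb :: "'k \<Rightarrow> 'n operator" where "Zb j \<equiv> weyl 1 0 (u j)"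

lemma encoder_V: "encoder (css_stabilizer C) Xb Zb V"
  unfolding encoder_def
proof (intro conjI allI)
  fix j
  show "Xb j ** V = V ** on_qubit j sigma_x"
    by (simp add: vec_eq_iff on_qubit_sigma_x weyl_mult_left weyl_mult_right V_def enc_add enc_axis add_ac)
  show "Zb j ** V = V ** on_qubit j sigma_z"
    by (auto simp add: vec_eq_iff on_qubit_sigma_z weyl_mult_left weyl_mult_right V_nth
        coord_def bit_dot_axis_left)
qed (rule V_isometry range_V)+

section \<open>Logical Hadamard and phase gates\<close>

lemma implements_logicalI:
  assumes "(\<lambda>s. U ** s ** dagger U) ` css_stabilizer C = css_stabilizer C" "U ** V = V ** L"
  shows "implements_logical (css_stabilizer C) Xb Zb U L"
  unfolding implements_logical_def
  using assms encoder_V by (intro conjI exI[of _ V] exI[of _ 1]) auto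

lemma implements_hadamard:
  "implements_logical (css_stabilizer C) Xb Zb (tensor (\<lambda>_. hadamard)) (tensor (\<lambda>_. hadamard))"
proof (rule implements_logicalI)
  let ?U = "tensor (\<lambda>_. hadamard) :: 'n operator"
  have conj: "?U ** weyl 1 g h ** dagger ?U = weyl 1 h g" if "g \<in> C" "h \<in> C" for g h
  proof -
    have "bit_dot g h = 0" using that C_subset by (auto simp: dual_code_def)
    then show ?thesis
      by (simp add: tensor_hadamard_weyl tensor_hadamard_unitary flip: matrix_mul_assoc)
  qed
  show "(\<lambda>s. ?U ** s ** dagger ?U) ` css_stabilizer C = css_stabilizer C"
    by (rule involution_image) (auto simp: conj intro!: css_stabilizerI elim!: css_stabilizerE)
next
  let ?w = "complex_of_real (sqrt 2)"
  have "?w ^ CARD('n) = ?w ^ CARD('k) * (?w * ?w) ^ r"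
    by (simp only: card_k[symmetric] power_add power_mult power2_eq_square)
  also have "?w * ?w = 2" by (simp flip: of_real_mult)
  \<comment> \<open>The character sum over \<open>C\<close> contributes 2^r, which accounts for the
    surplus of 2r factors of the square root of 2 in the physical normalisation.\<close>
  finally have norm: "2 ^ r / ?w ^ CARD('n) = 1 / ?w ^ CARD('k)" by simp
  have "(tensor (\<lambda>_. hadamard) ** V) $ x $ y = (V ** tensor (\<lambda>_. hadamard)) $ x $ y" for x y
  proof -
    have "(tensor (\<lambda>_. hadamard) ** V) $ x $ y
        = (\<Sum>z\<in>UNIV. bit_sign (bit_dot x z) / ?w ^ CARD('n) * V $ z $ y)"
      by (simp add: matrix_matrix_mult_def tensor_hadamard)
    also have "\<dots> = (\<Sum>g\<in>C. bit_sign (bit_dot x (g + enc y)) / ?w ^ CARD('n)) * amp"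
      by (rule sum_V_column)
    also have "\<dots> = (\<Sum>g\<in>C. bit_sign (bit_dot x g)) * (bit_sign (bit_dot x (enc y)) / ?w ^ CARD('n)) * amp"
      by (simp add: bit_dot_add_right bit_sign_add sum_distrib_right sum_divide_distrib)
    also have "\<dots> = (if x \<in> dual_code C
        then amp * (bit_sign (bit_dot (coord x) y) * (2 ^ r / ?w ^ CARD('n))) else 0)"
      by (simp add: character_sum[OF subspace_C] card_C bit_dot_enc)
    also have "\<dots> = (\<Sum>z\<in>UNIV. V $ x $ z * (bit_sign (bit_dot z y) / ?w ^ CARD('k)))"
      unfolding norm sum_V_row by simp
    also have "\<dots> = (V ** tensor (\<lambda>_. hadamard)) $ x $ y"
      by (simp add: matrix_matrix_mult_def tensor_hadamard)
    finally show ?thesis .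
  qed
  then show "tensor (\<lambda>_. hadamard) ** V = V ** tensor (\<lambda>_. hadamard)" by (simp add: vec_eq_iff)
qed

text \<open>The \<open>u j\<close> are pairwise orthogonal, so \<open>phase_add\<close> contributes
  no signs and the phases multiply.\<close>

lemma phase_enc:
  assumes b: "range b \<subseteq> {-1, 1}" and u: "\<And>j. phase b (u j) = \<i> powi a j"
  shows "phase b (enc y) = phase a y"
proof -
  have "phase b (\<Sum>j\<in>J. y $ j *s u j) = (\<Prod>j\<in>J. if y $ j = 0 then 1 else \<i> powi a j)" if "finite J" for J
    using that
  proof induction
    case (insert i J)
    have "bit_dot (y $ i *s u i) (\<Sum>j\<in>J. y $ j *s u j) = 0"
      unfolding bit_dot_sum_right bit_dot_scale_right bit_dot_commute[of "y $ i *s u i"] u_orthonormal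
      using insert.hyps by (intro sum.neutral) auto
    moreover have "phase b (y $ i *s u i) = (if y $ i = 0 then 1 else \<i> powi a i)"
      by (cases "y $ i") (auto simp: u)
    ultimately show ?case using insert by (simp add: phase_add[OF b])
  qed simp
  then show ?thesis by (simp add: enc_def phase_def[of a])
qed

lemma implements_phase:
  assumes b: "range b \<subseteq> {-1, 1}" and C: "\<And>g. g \<in> C \<Longrightarrow> phase b g = 1"
    and u: "\<And>j. phase b (u j) = \<i> powi a j"
  shows "implements_logical (css_stabilizer C) Xb Zb
    (tensor (\<lambda>q. phase_gate_pow (b q))) (tensor (\<lambda>j. phase_gate_pow (a j)))"
proof (rule implements_logicalI)
  let ?U = "tensor (\<lambda>q. phase_gate_pow (b q))"
  have conj: "?U ** weyl 1 g h ** dagger ?U = weyl 1 g (g + h)" if "g \<in> C" for g h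
    using that by (simp add: phase_gate_weyl[OF b] C phase_gate_unitary[OF b] flip: matrix_mul_assoc)
  show "(\<lambda>s. ?U ** s ** dagger ?U) ` css_stabilizer C = css_stabilizer C"
    by (rule involution_image)
      (auto simp: conj intro!: css_stabilizerI vec.subspace_add[OF subspace_C] elim!: css_stabilizerE)
  have "(?U ** V) $ x $ y = (V ** tensor (\<lambda>j. phase_gate_pow (a j))) $ x $ y" for x y
  proof (cases "x + enc y \<in> C")
    case True
    \<comment> \<open>\<open>x\<close> differs from \<open>enc y\<close> by an element of
      \<open>C\<close>, which has phase 1 and is orthogonal to \<open>enc y\<close>. Hence the phase
      is constant on the coset.\<close>
    then have "bit_dot (x + enc y) (enc y) = 0"
      using enc_in_dual[of y] by (subst bit_dot_commute) (simp add: dual_code_def)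
    then have "phase b ((x + enc y) + enc y) = phase b (enc y)"
      unfolding phase_add[OF b, of "x + enc y"] by (simp add: C[OF True])
    then have "phase b x = phase a y"
      by (simp add: add.assoc phase_enc[OF b u])
    then show ?thesis by (simp add: phase_gate_mult_left phase_gate_mult_right)
  next
    case False
    then show ?thesis by (simp add: phase_gate_mult_left phase_gate_mult_right V_def)
  qed
  then show "?U ** V = V ** tensor (\<lambda>j. phase_gate_pow (a j))" by (simp add: vec_eq_iff)
qed

lemma phases_exist:
  assumes a: "range a \<subseteq> {-1, 1}"
  obtains b :: "'n \<Rightarrow> int" where "range b \<subseteq> {-1, 1}" "\<And>g. g \<in> C \<Longrightarrow> phase b g = 1"
    "\<And>j. phase b (u j) = \<i> powi a j"
proof -
  define p :: "bit ^ 'n \<Rightarrow> complex" where "p = phase (\<lambda>_. 1)"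
  have p_add: "p (x + y) = p x * p y * bit_sign (bit_dot x y)" for x y
    unfolding p_def by (rule phase_add) auto
  have p_square: "p x * p x * bit_sign (bit_dot x x) = 1" for x
    using p_add[of x x] by (simp add: p_def)
  have C_orth: "bit_dot g h = 0" if "g \<in> C" "h \<in> C" for g h
    using that C_subset by (auto simp: dual_code_def)
  \<comment> \<open>On \<open>C\<close> self-products vanish, so \<open>p\<close> takes the values 1
    and -1 there; \<open>f\<close> is its exponent, and it is additive because \<open>C\<close> is
    self-orthogonal.\<close>
  define f where "f g = (if p g = 1 then 0 else 1 :: bit)" for g
  have sign_f: "bit_sign (f g) = p g" if "g \<in> C" for g
    using p_square[of g] that by (auto simp: f_def C_orth square_eq_1_iff)
  have "f (g + h) = f g + f h" if "g \<in> C" "h \<in> C" for g h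
  proof -
    have "bit_sign (f (g + h)) = bit_sign (f g + f h)"
      using that vec.subspace_add[OF subspace_C that] by (simp add: sign_f bit_sign_add p_add C_orth)
    then show ?thesis by (simp add: bit_sign_eq_iff)
  qed
  then obtain c where c: "\<And>g. g \<in> C \<Longrightarrow> f g = bit_dot c g"
    using additive_functional_is_dot[OF subspace_C] by metis
  \<comment> \<open>\<open>t\<close> marks the logical qubits whose sign is still wrong after the
    twist by \<open>c\<close>. Adding \<open>enc t\<close> to \<open>c\<close> corrects exactly
    these, as its product with \<open>u j\<close> is \<open>t $ j\<close>, and it changes nothing on
    \<open>C\<close>.\<close>
  define t :: "bit ^ 'k" where
    "t = (\<chi> j. if p (u j) * bit_sign (bit_dot c (u j)) = \<i> powi a j then 0 else 1)"
  have t: "p (u j) * bit_sign (bit_dot c (u j)) * bit_sign (t $ j) = \<i> powi a j" for j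
  proof -
    let ?z = "p (u j) * bit_sign (bit_dot c (u j))"
    have "?z * ?z = p (u j) * p (u j) * (bit_sign (bit_dot c (u j)) * bit_sign (bit_dot c (u j)))"
      by (simp only: mult_ac)
    \<comment> \<open>Since \<open>u j\<close> has square 1, both sides are -1.\<close>
    also have "\<dots> = \<i> powi a j * \<i> powi a j"
      using p_square[of "u j"] ipowi_cases[OF a, of j] by (auto simp: u_orthonormal minus_equation_iff)
    finally have "?z = \<i> powi a j \<or> ?z = - (\<i> powi a j)" by (simp only: square_eq_iff)
    then show ?thesis by (auto simp: t_def)
  qed
  define b where "b q = (if (c + enc t) $ q = 0 then 1 else - 1 :: int)" for q
  have b: "phase b x = p x * bit_sign (bit_dot (c + enc t) x)" for x
    unfolding b_def p_def by (rule phase_sign_twist)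
  show ?thesis
  proof
    show "range b \<subseteq> {-1, 1}" by (auto simp: b_def)
    show "phase b g = 1" if g: "g \<in> C" for g
    proof -
      have "bit_dot (enc t) g = 0" using g enc_in_dual by (auto simp: dual_code_def)
      then show ?thesis by (simp add: b bit_dot_add_left c[OF g, symmetric] sign_f g)
        (metis bit_sign_self sign_f g)
    qed
    show "phase b (u j) = \<i> powi a j" for j
    proof -
      have "bit_dot (enc t) (u j) = t $ j"
        using coord_enc[of t] by (simp add: bit_dot_commute[of _ "u j"] coord_def vec_eq_iff)
      then show ?thesis by (simp add: b bit_dot_add_left bit_sign_add mult.assoc flip: t)
    qed
  qed
qed

section \<open>The symplectic basis and its compatibility\<close>

lemma symplectic_basis_XZ: "symplectic_basis (css_stabilizer C) Xb Zb"
proof -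
  let ?cent = "centralizer (css_stabilizer C)"
  define G where "G = generate pauli_group (css_stabilizer C \<union> {mat \<i>} \<union> range Xb \<union> range Zb)"
  note cent = centralizer_css_stabilizer[OF subspace_C]
  have cent_I: "weyl c x z \<in> ?cent" if "c ^ 4 = 1" "x \<in> dual_code C" "z \<in> dual_code C" for c x z
    using that unfolding cent by blast
  have zero: "0 \<in> dual_code C" by (rule vec.subspace_0[OF subspace_dual_code])
  have gens: "css_stabilizer C \<union> {mat \<i>} \<union> range Xb \<union> range Zb \<subseteq> ?cent"
    using C_subset u_dual zero by (auto simp: mat_eq_weyl intro!: cent_I elim!: css_stabilizerE)
  have sub_cent: "subgroup ?cent pauli_group"
  proof (rule pauli_subgroupI)
    show "?cent \<subseteq> pauli_ops" by (auto simp: centralizer_def)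
    show "mat 1 \<in> ?cent" by (simp add: mat_eq_weyl cent_I zero)
    show "P ** Q \<in> ?cent" if PQ: "P \<in> ?cent" "Q \<in> ?cent" for P Q
    proof -
      obtain c x z c' x' z' where "P = weyl c x z" "Q = weyl c' x' z'"
        and "c ^ 4 = 1" "c' ^ 4 = 1" and "x \<in> dual_code C" "z \<in> dual_code C" "x' \<in> dual_code C" "z' \<in> dual_code C"
        using PQ unfolding cent by blast
      then show ?thesis
        by (auto simp: weyl_mult_weyl power_mult_distrib intro!: cent_I vec.subspace_add[OF subspace_dual_code])
    qed
    show "\<exists>Q\<in>?cent. Q ** P = mat 1" if P: "P \<in> ?cent" for P
    proof -
      obtain c x z where P_eq: "P = weyl c x z" and c: "c ^ 4 = 1" and "x \<in> dual_code C" "z \<in> dual_code C"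
        using P unfolding cent by blast
      moreover have "(c ^ 3 * bit_sign (bit_dot z x)) ^ 4 = 1"
        using c by (simp only: power_mult_distrib power_power4 bit_sign_power4 mult_1)
      ultimately have "weyl (c ^ 3 * bit_sign (bit_dot z x)) x z \<in> ?cent" by (intro cent_I)
      moreover have "weyl (c ^ 3 * bit_sign (bit_dot z x)) x z ** P = mat 1"
        unfolding P_eq using c by (rule weyl_inverse)
      ultimately show ?thesis by blast
    qed
  qed
  have "G = ?cent"
  proof
    show "G \<subseteq> ?cent"
      unfolding G_def
      by (rule group.generate_subgroup_incl[OF group_pauli_group gens sub_cent])
    have G: "subgroup G pauli_group"
      unfolding G_def by (rule group.generate_is_subgroup[OF group_pauli_group])
        (use gens in \<open>auto simp: pauli_group_def centralizer_def\<close>)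
    have gen: "P \<in> G" if "P \<in> css_stabilizer C \<union> {mat \<i>} \<union> range Xb \<union> range Zb" for P
      unfolding G_def by (rule generate.incl) (use that in auto)
    \<comment> \<open>Each \<open>x\<close> in \<open>dual_code C\<close> is the sum of
      \<open>x + enc (coord x)\<close>, which lies in \<open>C\<close>, and a combination of the
      \<open>u j\<close>. Applied to the X-part and the Z-part of \<open>G\<close>, this yields all
      of the centralizer up to powers of \<open>\<i>\<close>.\<close>
    have dual_subset: "dual_code C \<subseteq> A" if A: "vec.subspace A" "C \<subseteq> A" "\<And>j. u j \<in> A" for A
    proof
      fix x assume "x \<in> dual_code C"
      then have "x + enc (coord x) \<in> A" using A(2) add_enc_in_C_iff by blast
      moreover have "enc (coord x) \<in> A"
        unfolding enc_def by (intro vec.subspace_sum vec.subspace_scale A)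
      ultimately have "(x + enc (coord x)) + enc (coord x) \<in> A" by (rule vec.subspace_add[OF A(1)])
      then show "x \<in> A" by (simp add: add.assoc)
    qed
    have X: "dual_code C \<subseteq> {x. weyl 1 x 0 \<in> G}"
      by (rule dual_subset[OF subspace_x_part[OF G]])
        (use vec.subspace_0[OF subspace_C] in \<open>auto intro!: gen css_stabilizerI\<close>)
    have Z: "dual_code C \<subseteq> {z. weyl 1 0 z \<in> G}"
      by (rule dual_subset[OF subspace_z_part[OF G]])
        (use vec.subspace_0[OF subspace_C] in \<open>auto intro!: gen css_stabilizerI\<close>)
    have phase: "weyl (\<i> ^ m) 0 0 \<in> G" for m
    proof (induction m)
      case 0
      then show ?case using X zero by auto
    next
      case (Suc m)
      have "mat \<i> ** weyl (\<i> ^ m) 0 0 \<in> G"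
        by (rule subgroup_mult_closed[OF G gen Suc]) simp
      then show ?case by (simp add: mat_eq_weyl weyl_mult_weyl)
    qed
    show "?cent \<subseteq> G"
    proof
      fix P assume "P \<in> ?cent"
      then obtain c x z where P: "P = weyl c x z" "c ^ 4 = 1" "x \<in> dual_code C" "z \<in> dual_code C"
        unfolding cent by blast
      then obtain m where "c = \<i> ^ m" using power4_eq_1_iff by blast
      then have "P = weyl (\<i> ^ m) 0 0 ** (weyl 1 x 0 ** weyl 1 0 z)"
        by (simp add: P weyl_mult_weyl)
      moreover have "weyl 1 x 0 \<in> G" "weyl 1 0 z \<in> G" using P X Z by auto
      ultimately show "P \<in> G" using phase subgroup_mult_closed[OF G] by simp
    qed
  qed
  moreover have "range Xb \<subseteq> ?cent" "range Zb \<subseteq> ?cent" using gens by blast+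
  ultimately show ?thesis
    unfolding symplectic_basis_def G_def
    by (auto simp: weyl_mult_weyl minus_weyl u_orthonormal add.commute)
qed

lemma compatible_XZ: "multilevel_transversal_compatible (css_stabilizer C) Xb Zb"
  unfolding multilevel_transversal_compatible_def
proof (intro conjI allI impI)
  fix a :: "'k \<Rightarrow> int" assume a: "range a \<subseteq> {-1, 1}"
  show "\<exists>b. range b \<subseteq> {-1, 1} \<and> implements_logical (css_stabilizer C) Xb Zb
      (tensor (\<lambda>i. phase_gate_pow (b i))) (tensor (\<lambda>j. phase_gate_pow (a j)))"
    by (rule phases_exist[OF a], intro exI conjI, assumption, rule implements_phase)
qed (rule implements_hadamard)

end

theorem corollary1:
  fixes H :: "nat \<Rightarrow> bit ^ 'n::finite" and n k d r :: nat
  assumes "CARD('n) = n" and "CARD('k::finite) = k"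
    and "self_dual_check_matrix r H"
    and "k + 2 * r = n" and "d = distance (stabilizer r H)"
    and "k \<ge> 1" and "odd n"
  shows "\<exists>Xb Zb :: 'k \<Rightarrow> 'n operator.
           symplectic_basis (stabilizer r H) Xb Zb \<and>
           multilevel_transversal_compatible (stabilizer r H) Xb Zb"
proof -
  define C where "C = vec.span (H ` {1..r})"
  have C: "vec.subspace C" unfolding C_def by (rule vec.subspace_span)
  \<comment> \<open>By double duality the dual of the linear code is the row space \<open>C\<close>,
    so the hypothesis on the check matrix becomes self-orthogonality of \<open>C\<close>.\<close>
  have "linear_code r H = dual_code C"
    unfolding C_def dual_code_span by (auto simp: linear_code_def dual_code_def bit_dot_commute)
  then have C_subset: "C \<subseteq> dual_code C"
    using assms(3) dual_dual_code[OF C] by (simp add: self_dual_check_matrix_def)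
  have card_C: "card C = 2 ^ r"
    using assms(3) unfolding C_def card_span by (simp add: self_dual_check_matrix_def)
  have card_k: "CARD('k) + 2 * r = CARD('n)" and "odd CARD('n)" using assms by auto
  obtain u :: "'k \<Rightarrow> bit ^ 'n" where "\<And>j. u j \<in> dual_code C"
    and "\<And>i j. bit_dot (u i) (u j) = (if i = j then 1 else 0)"
    and "\<And>x. x \<in> dual_code C \<Longrightarrow> (\<And>j. bit_dot (u j) x = 0) \<Longrightarrow> x \<in> C"
    by (rule logical_vectors_exist[OF C C_subset card_C card_k \<open>odd CARD('n)\<close>]) metis
  then interpret logical_vectors C u r
    by unfold_locales (use C C_subset card_C card_k in blast)+
  have "stabilizer r H = css_stabilizer C"
    unfolding C_def by (rule stabilizer_eq_css_stabilizer) (use C_subset C_def in simp)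
  then show ?thesis using symplectic_basis_XZ compatible_XZ by auto
qed

end
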